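(* Let $L:\mathcal U\to\mathbb R$ be a conic pseudo-Finslerian metric on $M$ and $\mathcal L=\tfrac12L$. Let $\gamma$ be a motion of a dissipative mechanical system $\mathcal M=(M,\mathcal L,\mathcal F)$ with $\mathcal F(v)=-\nabla^v\phi+Y(v)$, where $\phi:M\to\mathbb R$ is smooth and $Y$ is a dissipative anisotropic vector field, and let $\mathcal E=\mathcal L+\phi\circ\pi$ be the total energy of the associated conservative system $(M,\mathcal L,-\nabla^v\phi)$. Then $t\mapsto\mathcal E(\gamma'(t))$ is (strictly) decreasing.
   Context: Let $M$ be a smooth manifold, $\pi:TM\to M$ the projection, and $\mathcal U\subset TM\setminus 0$ an open set invariant under positive scalar multiplication. A conic pseudo-Finslerian metric is a smooth function $L:\mathcal U\to\mathbb R$ with $L(\lambda v)=\lambda^2L(v)$ for $\lambda>0$ whose fundamental tensor $g_v(u,w)=\tfrac12\frac{\partial^2}{\partial t\partial s}\big|_{t=s=0}L(v+tu+sw)$, $u,w\in T_{\pi(v)}M$, is nondegenerate for every $v\in\mathcal U$. An anisotropic vector field is a smooth map $X:\mathcal U\to TM$ with $X(v)\in T_{\pi(v)}M$. It is dissipative if $g_v(v,X(v))<0$ for every $v\in\mathcal U$. The anisotropic gradient of a smooth $f:M\to\mathbb R$ is the anisotropic vector field $v\mapsto\nabla^vf$ defined by $g_v(\nabla^vf,w)=df_{\pi(v)}(w)$ for all $w\in T_{\pi(v)}M$. An anisotropic linear connection is a map $(v,X,Y)\in\mathcal U\times\mathfrak X(M)\times\mathfrak X(M)\mapsto\nabla^v_XY\in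 T_{\pi(v)}M$, with $v\mapsto \nabla^v_XY$ an anisotropic vector field, such that for each local vector field $V$ with values in $\mathcal U$, $\nabla^V$ is a linear connection on the domain of $V$. The Chern connection of $L$ is the unique anisotropic linear connection that is torsion-free ($\nabla^v_XY-\nabla^v_YX=[X,Y]$) and metric-compatible: $Xg_V(Y,Z)=g_V(\nabla^V_XY,Z)+g_V(Y,\nabla^V_XZ)+2C_V(Y,Z,\nabla^V_XV)$, where $C_v(u_1,u_2,u_3)=\tfrac12\frac{d}{dt}\big|_{t=0}g_{v+tu_1}(u_2,u_3)$. In coordinates put $\nabla^v_{\partial_i}\partial_j=\sum_k\Gamma^k_{ij}(v)\partial_k$. For a smooth curve $\gamma$ with $\gamma'\in\mathcal U$ ($\mathcal U$-admissible) and a vector field $X=\sum_kx_k\,\partial_k\circ\gamma$ along $\gamma$, $D^{\gamma'}_\gamma X=\sum_k\{x_k'+\sum_{ij}\Gamma^k_{ij}(\gamma')\gamma_i'x_j\}\partial_k$. A motion of a mechanical system $(M,\tfrac12L,\mathcal F)$ ($\mathcal F$ an anisotropic vector field) is a $\mathcal U$-admissible smooth curve with $D^{\gamma'}_\gamma\gamma'=\mathcal F(\gamma')$. The system is dissipative if $\mathcal F(v)=-\nabla^v\phi+Y(v)$ with $\phi$ smooth and $Y$ dissipative. *)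

theory Defs
  imports "HOL-Analysis.Analysis"
begin

text \<open>Infinitely differentiable maps. Derivatives are taken within the set, so the same notion
  serves open sets and (with one-sided derivatives at endpoints) nondegenerate real intervals;
  it is used for no other kind of set.\<close>

fun Ck_on :: "nat \<Rightarrow> 'a::real_normed_vector set \<Rightarrow> ('a \<Rightarrow> 'b::real_normed_vector) \<Rightarrow> bool" where
  "Ck_on 0 S f \<longleftrightarrow> continuous_on S f"
| "Ck_on (Suc k) S f \<longleftrightarrow>
     f differentiable_on S \<and> (\<forall>w. Ck_on k S (\<lambda>x. frechet_derivative f (at x within S) w))"

definition smooth_map_on :: "'a::real_normed_vector set \<Rightarrow> ('a \<Rightarrow> 'b::real_normed_vector) \<Rightarrow> bool" where
  "smooth_map_on S f \<longleftrightarrow> (\<forall>k. Ck_on k S f)"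

section \<open>Smooth manifolds\<close>

text \<open>The manifold is the whole type \<open>'m\<close> (Hausdorff and second countable in the final statement),
  with smooth structure given by an atlas. A chart is a pair of its domain and its coordinate map.\<close>

type_synonym ('m, 'n) chart = "'m set \<times> ('m \<Rightarrow> real ^ 'n)"

definition chart_inv :: "('m, 'n) chart \<Rightarrow> real ^ 'n \<Rightarrow> 'm" where
  "chart_inv c = inv_into (fst c) (snd c)"

definition transition :: "('m, 'n) chart \<Rightarrow> ('m, 'n) chart \<Rightarrow> real ^ 'n \<Rightarrow> real ^ 'n" where
  "transition c c' = snd c' \<circ> chart_inv c"

definition smooth_atlas :: "('m::topological_space, 'n::finite) chart set \<Rightarrow> bool" where
  "smooth_atlas A \<longleftrightarrow>
     (\<Union>c\<in>A. fst c) = UNIV \<and>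
     (\<forall>c\<in>A. open (fst c) \<and> open (snd c ` fst c) \<and>
        homeomorphism (fst c) (snd c ` fst c) (snd c) (chart_inv c)) \<and>
     (\<forall>c\<in>A. \<forall>c'\<in>A. smooth_map_on (snd c ` (fst c \<inter> fst c')) (transition c c'))"

definition smooth_fun_on ::
  "('m, 'n::finite) chart set \<Rightarrow> 'm set \<Rightarrow> ('m \<Rightarrow> real) \<Rightarrow> bool" where
  "smooth_fun_on A \<Omega> f \<longleftrightarrow> (\<forall>c\<in>A. smooth_map_on (snd c ` (fst c \<inter> \<Omega>)) (f \<circ> chart_inv c))"

section \<open>Tangent bundle\<close>

text \<open>A tangent vector at \<open>p\<close> is \<open>p\<close> together with the family of its component vectors in
  all charts around \<open>p\<close>, related by the Jacobians of the transition maps. The components in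
  charts not containing \<open>p\<close> are set to 0, so that a tangent vector has only one representation.
  The projection \<open>\<pi>\<close> is \<^const>\<open>fst\<close>.\<close>

type_synonym ('m, 'n) tvec = "'m \<times> (('m, 'n) chart \<Rightarrow> real ^ 'n)"

definition tangent_space :: "('m, 'n::finite) chart set \<Rightarrow> 'm \<Rightarrow> ('m, 'n) tvec set" where
  "tangent_space A p = {v. fst v = p \<and>
     (\<forall>c. c \<notin> A \<or> p \<notin> fst c \<longrightarrow> snd v c = 0) \<and>
     (\<forall>c\<in>A. \<forall>c'\<in>A. p \<in> fst c \<inter> fst c' \<longrightarrow>
        snd v c' = frechet_derivative (transition c c') (at (snd c p)) (snd v c))}"

definition tangent_bundle :: "('m, 'n::finite) chart set \<Rightarrow> ('m, 'n) tvec set" where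
  "tangent_bundle A = (\<Union>p. tangent_space A p)"

definition tzero :: "'m \<Rightarrow> ('m, 'n::finite) tvec" where
  "tzero p = (p, \<lambda>c. 0)"

definition tadd :: "('m, 'n::finite) tvec \<Rightarrow> ('m, 'n) tvec \<Rightarrow> ('m, 'n) tvec"  (infixl "\<oplus>\<^sub>T" 65) where
  "v \<oplus>\<^sub>T w = (fst v, \<lambda>c. snd v c + snd w c)"

definition tscale :: "real \<Rightarrow> ('m, 'n::finite) tvec \<Rightarrow> ('m, 'n) tvec"  (infixr "\<cdot>\<^sub>T" 75) where
  "a \<cdot>\<^sub>T v = (fst v, \<lambda>c. a *\<^sub>R snd v c)"

text \<open>The chart of the tangent bundle induced by a chart of the manifold; these charts define
  the topology and the smooth structure of the tangent bundle.\<close>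

definition bundle_chart :: "('m, 'n) chart \<Rightarrow> ('m, 'n) tvec \<Rightarrow> (real ^ 'n) \<times> (real ^ 'n)" where
  "bundle_chart c v = (snd c (fst v), snd v c)"

definition bundle_chart_inv ::
  "('m, 'n::finite) chart set \<Rightarrow> ('m, 'n) chart \<Rightarrow> (real ^ 'n) \<times> (real ^ 'n) \<Rightarrow> ('m, 'n) tvec" where
  "bundle_chart_inv A c = inv_into {v \<in> tangent_bundle A. fst v \<in> fst c} (bundle_chart c)"

definition bundle_chart_image ::
  "('m, 'n::finite) chart \<Rightarrow> ('m, 'n) tvec set \<Rightarrow> ((real ^ 'n) \<times> (real ^ 'n)) set" where
  "bundle_chart_image c U = bundle_chart c ` {v \<in> U. fst v \<in> fst c}"

text \<open>Open subsets of \<open>TM \<setminus> 0\<close> that are invariant under positive scalar multiplication.\<close>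

definition conic_domain :: "('m, 'n::finite) chart set \<Rightarrow> ('m, 'n) tvec set \<Rightarrow> bool" where
  "conic_domain A U \<longleftrightarrow>
     U \<subseteq> tangent_bundle A - range tzero \<and>
     (\<forall>c\<in>A. open (bundle_chart_image c U)) \<and>
     (\<forall>v\<in>U. \<forall>r>0. r \<cdot>\<^sub>T v \<in> U)"

definition vector_field_on ::
  "('m, 'n::finite) chart set \<Rightarrow> 'm set \<Rightarrow> ('m \<Rightarrow> ('m, 'n) tvec) \<Rightarrow> bool" where
  "vector_field_on A \<Omega> X \<longleftrightarrow>
     (\<forall>p\<in>\<Omega>. X p \<in> tangent_space A p) \<and>
     (\<forall>c\<in>A. smooth_map_on (snd c ` (fst c \<inter> \<Omega>)) (\<lambda>x. snd (X (chart_inv c x)) c))"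

text \<open>The differential of \<open>f\<close> on the tangent vector \<open>w\<close>; any chart around the base point
  gives the same value.\<close>

definition differential :: "('m, 'n::finite) chart set \<Rightarrow> ('m \<Rightarrow> real) \<Rightarrow> ('m, 'n) tvec \<Rightarrow> real" where
  "differential A f w = (let c = (SOME c. c \<in> A \<and> fst w \<in> fst c) in
     frechet_derivative (f \<circ> chart_inv c) (at (snd c (fst w))) (snd w c))"

text \<open>\<open>[X, Y]\<^sup>k = X\<^sup>i \<partial>\<^sub>i Y\<^sup>k - Y\<^sup>i \<partial>\<^sub>i X\<^sup>k\<close> in each chart.\<close>

definition lie_bracket :: "('m, 'n::finite) chart set \<Rightarrow>
    ('m \<Rightarrow> ('m, 'n) tvec) \<Rightarrow> ('m \<Rightarrow> ('m, 'n) tvec) \<Rightarrow> 'm \<Rightarrow> ('m, 'n) tvec" where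
  "lie_bracket A X Y p = (p, \<lambda>c. if c \<in> A \<and> p \<in> fst c then
       frechet_derivative (\<lambda>x. snd (Y (chart_inv c x)) c) (at (snd c p)) (snd (X p) c)
     - frechet_derivative (\<lambda>x. snd (X (chart_inv c x)) c) (at (snd c p)) (snd (Y p) c)
     else 0)"

definition coordinate_field ::
  "('m, 'n::finite) chart set \<Rightarrow> ('m, 'n) chart \<Rightarrow> 'n \<Rightarrow> 'm \<Rightarrow> ('m, 'n) tvec" where
  "coordinate_field A c i p = bundle_chart_inv A c (snd c p, axis i 1)"

section \<open>Conic pseudo-Finslerian metrics\<close>

definition fundamental_tensor :: "(('m, 'n::finite) tvec \<Rightarrow> real) \<Rightarrow>
    ('m, 'n) tvec \<Rightarrow> ('m, 'n) tvec \<Rightarrow> ('m, 'n) tvec \<Rightarrow> real" where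
  "fundamental_tensor L v u w =
     1/2 * deriv (\<lambda>t. deriv (\<lambda>s. L (v \<oplus>\<^sub>T t \<cdot>\<^sub>T u \<oplus>\<^sub>T s \<cdot>\<^sub>T w)) 0) 0"

definition cartan_tensor :: "(('m, 'n::finite) tvec \<Rightarrow> real) \<Rightarrow>
    ('m, 'n) tvec \<Rightarrow> ('m, 'n) tvec \<Rightarrow> ('m, 'n) tvec \<Rightarrow> ('m, 'n) tvec \<Rightarrow> real" where
  "cartan_tensor L v u1 u2 u3 =
     1/2 * deriv (\<lambda>t. fundamental_tensor L (v \<oplus>\<^sub>T t \<cdot>\<^sub>T u1) u2 u3) 0"

definition conic_pseudo_finsler :: "('m, 'n::finite) chart set \<Rightarrow>
    ('m, 'n) tvec set \<Rightarrow> (('m, 'n) tvec \<Rightarrow> real) \<Rightarrow> bool" where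
  "conic_pseudo_finsler A U L \<longleftrightarrow>
     conic_domain A U \<and>
     (\<forall>c\<in>A. smooth_map_on (bundle_chart_image c U) (L \<circ> bundle_chart_inv A c)) \<and>
     (\<forall>v\<in>U. \<forall>r>0. L (r \<cdot>\<^sub>T v) = r\<^sup>2 * L v) \<and>
     (\<forall>v\<in>U. \<forall>u\<in>tangent_space A (fst v).
        (\<forall>w\<in>tangent_space A (fst v). fundamental_tensor L v u w = 0) \<longrightarrow> u = tzero (fst v))"

section \<open>Anisotropic vector fields\<close>

definition anisotropic_field :: "('m, 'n::finite) chart set \<Rightarrow>
    ('m, 'n) tvec set \<Rightarrow> (('m, 'n) tvec \<Rightarrow> ('m, 'n) tvec) \<Rightarrow> bool" where
  "anisotropic_field A U X \<longleftrightarrow>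
     (\<forall>v\<in>U. X v \<in> tangent_space A (fst v)) \<and>
     (\<forall>c\<in>A. smooth_map_on (bundle_chart_image c U) (\<lambda>z. snd (X (bundle_chart_inv A c z)) c))"

definition dissipative_field :: "('m, 'n::finite) chart set \<Rightarrow> ('m, 'n) tvec set \<Rightarrow>
    (('m, 'n) tvec \<Rightarrow> real) \<Rightarrow> (('m, 'n) tvec \<Rightarrow> ('m, 'n) tvec) \<Rightarrow> bool" where
  "dissipative_field A U L Y \<longleftrightarrow>
     anisotropic_field A U Y \<and> (\<forall>v\<in>U. fundamental_tensor L v v (Y v) < 0)"

definition anisotropic_gradient :: "('m, 'n::finite) chart set \<Rightarrow>
    (('m, 'n) tvec \<Rightarrow> real) \<Rightarrow> ('m \<Rightarrow> real) \<Rightarrow> ('m, 'n) tvec \<Rightarrow> ('m, 'n) tvec" where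
  "anisotropic_gradient A L f v = (THE u. u \<in> tangent_space A (fst v) \<and>
     (\<forall>w\<in>tangent_space A (fst v). fundamental_tensor L v u w = differential A f w))"

section \<open>Anisotropic connections and the Chern connection\<close>

text \<open>A linear connection on the open set \<open>\<Omega>\<close>. Vector fields on \<open>\<Omega>\<close> are represented by total
  functions, whence the first clause.\<close>

definition linear_connection_on :: "('m, 'n::finite) chart set \<Rightarrow> 'm set \<Rightarrow>
    (('m \<Rightarrow> ('m, 'n) tvec) \<Rightarrow> ('m \<Rightarrow> ('m, 'n) tvec) \<Rightarrow> 'm \<Rightarrow> ('m, 'n) tvec) \<Rightarrow> bool" where
  "linear_connection_on A \<Omega> D \<longleftrightarrow>
     (\<forall>X X' Y Y'. vector_field_on A \<Omega> X \<and> vector_field_on A \<Omega> Y \<and>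
        (\<forall>p\<in>\<Omega>. X p = X' p \<and> Y p = Y' p) \<longrightarrow> (\<forall>p\<in>\<Omega>. D X Y p = D X' Y' p)) \<and>
     (\<forall>X Y. vector_field_on A \<Omega> X \<and> vector_field_on A \<Omega> Y \<longrightarrow> vector_field_on A \<Omega> (D X Y)) \<and>
     (\<forall>X X' Y. vector_field_on A \<Omega> X \<and> vector_field_on A \<Omega> X' \<and> vector_field_on A \<Omega> Y \<longrightarrow>
        (\<forall>p\<in>\<Omega>. D (\<lambda>q. X q \<oplus>\<^sub>T X' q) Y p = D X Y p \<oplus>\<^sub>T D X' Y p)) \<and>
     (\<forall>h X Y. smooth_fun_on A \<Omega> h \<and> vector_field_on A \<Omega> X \<and> vector_field_on A \<Omega> Y \<longrightarrow>
        (\<forall>p\<in>\<Omega>. D (\<lambda>q. h q \<cdot>\<^sub>T X q) Y p = h p \<cdot>\<^sub>T D X Y p)) \<and>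
     (\<forall>X Y Y'. vector_field_on A \<Omega> X \<and> vector_field_on A \<Omega> Y \<and> vector_field_on A \<Omega> Y' \<longrightarrow>
        (\<forall>p\<in>\<Omega>. D X (\<lambda>q. Y q \<oplus>\<^sub>T Y' q) p = D X Y p \<oplus>\<^sub>T D X Y' p)) \<and>
     (\<forall>h X Y. smooth_fun_on A \<Omega> h \<and> vector_field_on A \<Omega> X \<and> vector_field_on A \<Omega> Y \<longrightarrow>
        (\<forall>p\<in>\<Omega>. D X (\<lambda>q. h q \<cdot>\<^sub>T Y q) p = h p \<cdot>\<^sub>T D X Y p \<oplus>\<^sub>T differential A h (X p) \<cdot>\<^sub>T Y p))"

text \<open>An anisotropic connection \<open>(v, X, Y) \<mapsto> \<nabla>\<^sup>v\<^sub>X Y\<close> takes global vector fields. Like every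
  connection it depends only on germs, and so it is evaluated on fields defined merely near
  \<open>\<pi> v\<close> (such as coordinate fields) by replacing them with global fields of the same germ.\<close>

type_synonym ('m, 'n) aniso_conn =
  "('m, 'n) tvec \<Rightarrow> ('m \<Rightarrow> ('m, 'n) tvec) \<Rightarrow> ('m \<Rightarrow> ('m, 'n) tvec) \<Rightarrow> ('m, 'n) tvec"

definition global_extension :: "('m::topological_space, 'n::finite) chart set \<Rightarrow> 'm \<Rightarrow>
    ('m \<Rightarrow> ('m, 'n) tvec) \<Rightarrow> 'm \<Rightarrow> ('m, 'n) tvec" where
  "global_extension A p X =
     (SOME X'. vector_field_on A UNIV X' \<and> eventually (\<lambda>q. X' q = X q) (nhds p))"

definition local_value ::
  "('m::topological_space, 'n::finite) chart set \<Rightarrow> ('m, 'n) aniso_conn \<Rightarrow> ('m, 'n) aniso_conn" where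
  "local_value A nabla v X Y = nabla v (global_extension A (fst v) X) (global_extension A (fst v) Y)"

text \<open>The connection \<open>\<nabla>\<^sup>V\<close> on the domain of a local vector field \<open>V\<close>.\<close>

definition connection_along :: "('m::topological_space, 'n::finite) chart set \<Rightarrow>
    ('m, 'n) aniso_conn \<Rightarrow> ('m \<Rightarrow> ('m, 'n) tvec) \<Rightarrow>
    ('m \<Rightarrow> ('m, 'n) tvec) \<Rightarrow> ('m \<Rightarrow> ('m, 'n) tvec) \<Rightarrow> 'm \<Rightarrow> ('m, 'n) tvec" where
  "connection_along A nabla V X Y p = local_value A nabla (V p) X Y"

definition anisotropic_connection :: "('m::topological_space, 'n::finite) chart set \<Rightarrow>
    ('m, 'n) tvec set \<Rightarrow> ('m, 'n) aniso_conn \<Rightarrow> bool" where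
  "anisotropic_connection A U nabla \<longleftrightarrow>
     (\<forall>X Y. vector_field_on A UNIV X \<and> vector_field_on A UNIV Y \<longrightarrow>
        anisotropic_field A U (\<lambda>v. nabla v X Y)) \<and>
     (\<forall>\<Omega> V. open \<Omega> \<and> vector_field_on A \<Omega> V \<and> V ` \<Omega> \<subseteq> U \<longrightarrow>
        linear_connection_on A \<Omega> (connection_along A nabla V) \<and>
        (\<forall>X Y. vector_field_on A UNIV X \<and> vector_field_on A UNIV Y \<longrightarrow>
           (\<forall>p\<in>\<Omega>. connection_along A nabla V X Y p = nabla (V p) X Y)))"

definition torsion_free :: "('m::topological_space, 'n::finite) chart set \<Rightarrow>
    ('m, 'n) tvec set \<Rightarrow> ('m, 'n) aniso_conn \<Rightarrow> bool" where
  "torsion_free A U nabla \<longleftrightarrow>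
     (\<forall>v\<in>U. \<forall>X Y. vector_field_on A UNIV X \<and> vector_field_on A UNIV Y \<longrightarrow>
        nabla v X Y \<oplus>\<^sub>T (-1) \<cdot>\<^sub>T nabla v Y X = lie_bracket A X Y (fst v))"

definition metric_compatible :: "('m::topological_space, 'n::finite) chart set \<Rightarrow>
    ('m, 'n) tvec set \<Rightarrow> (('m, 'n) tvec \<Rightarrow> real) \<Rightarrow> ('m, 'n) aniso_conn \<Rightarrow> bool" where
  "metric_compatible A U L nabla \<longleftrightarrow>
     (\<forall>\<Omega> V X Y Z. open \<Omega> \<and> vector_field_on A \<Omega> V \<and> V ` \<Omega> \<subseteq> U \<and>
        vector_field_on A \<Omega> X \<and> vector_field_on A \<Omega> Y \<and> vector_field_on A \<Omega> Z \<longrightarrow>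
        (\<forall>p\<in>\<Omega>. differential A (\<lambda>q. fundamental_tensor L (V q) (Y q) (Z q)) (X p) =
             fundamental_tensor L (V p) (connection_along A nabla V X Y p) (Z p)
           + fundamental_tensor L (V p) (Y p) (connection_along A nabla V X Z p)
           + 2 * cartan_tensor L (V p) (Y p) (Z p) (connection_along A nabla V X V p)))"

definition chern_connection :: "('m::topological_space, 'n::finite) chart set \<Rightarrow>
    ('m, 'n) tvec set \<Rightarrow> (('m, 'n) tvec \<Rightarrow> real) \<Rightarrow> ('m, 'n) aniso_conn \<Rightarrow> bool" where
  "chern_connection A U L nabla \<longleftrightarrow>
     anisotropic_connection A U nabla \<and> torsion_free A U nabla \<and> metric_compatible A U L nabla"

definition christoffel :: "('m::topological_space, 'n::finite) chart set \<Rightarrow> ('m, 'n) aniso_conn \<Rightarrow>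
    ('m, 'n) chart \<Rightarrow> ('m, 'n) tvec \<Rightarrow> 'n \<Rightarrow> 'n \<Rightarrow> 'n \<Rightarrow> real" where
  "christoffel A nabla c v i j k =
     snd (local_value A nabla v (coordinate_field A c i) (coordinate_field A c j)) c $ k"

section \<open>Curves and motions\<close>

text \<open>Curves are parametrized by an arbitrary nondegenerate interval; derivatives at endpoints
  belonging to it are one-sided.\<close>

definition smooth_curve :: "('m::topological_space, 'n::finite) chart set \<Rightarrow>
    real set \<Rightarrow> (real \<Rightarrow> 'm) \<Rightarrow> bool" where
  "smooth_curve A I \<gamma> \<longleftrightarrow>
     is_interval I \<and> interior I \<noteq> {} \<and> continuous_on I \<gamma> \<and>
     (\<forall>c\<in>A. smooth_map_on {t \<in> I. \<gamma> t \<in> fst c} (snd c \<circ> \<gamma>))"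

definition velocity :: "('m, 'n::finite) chart set \<Rightarrow>
    real set \<Rightarrow> (real \<Rightarrow> 'm) \<Rightarrow> real \<Rightarrow> ('m, 'n) tvec" where
  "velocity A I \<gamma> t = (\<gamma> t, \<lambda>c. if c \<in> A \<and> \<gamma> t \<in> fst c
     then vector_derivative (snd c \<circ> \<gamma>) (at t within I) else 0)"

text \<open>The covariant derivative \<open>D\<^sub>\<gamma> X\<close> with reference vector \<open>\<gamma>'\<close>, for \<open>X\<close> a vector field along
  \<open>\<gamma>\<close>, given by its coordinate expression in every chart.\<close>

definition covariant_derivative :: "('m::topological_space, 'n::finite) chart set \<Rightarrow>
    ('m, 'n) aniso_conn \<Rightarrow> real set \<Rightarrow> (real \<Rightarrow> 'm) \<Rightarrow> (real \<Rightarrow> ('m, 'n) tvec) \<Rightarrow>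
    real \<Rightarrow> ('m, 'n) tvec" where
  "covariant_derivative A nabla I \<gamma> X t = (\<gamma> t, \<lambda>c. if c \<in> A \<and> \<gamma> t \<in> fst c
     then \<chi> k. vector_derivative (\<lambda>s. snd (X s) c $ k) (at t within I) +
            (\<Sum>i\<in>UNIV. \<Sum>j\<in>UNIV. christoffel A nabla c (velocity A I \<gamma> t) i j k *
               (snd (velocity A I \<gamma> t) c $ i) * (snd (X t) c $ j))
     else 0)"

text \<open>The system \<open>(M, L/2, F)\<close> is specified by \<open>L\<close> and \<open>F\<close>; \<open>nabla\<close> is the Chern connection
  of \<open>L\<close>.\<close>

definition motion :: "('m::topological_space, 'n::finite) chart set \<Rightarrow> ('m, 'n) tvec set \<Rightarrow>
    ('m, 'n) aniso_conn \<Rightarrow> (('m, 'n) tvec \<Rightarrow> ('m, 'n) tvec) \<Rightarrow> real set \<Rightarrow> (real \<Rightarrow> 'm) \<Rightarrow> bool" where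
  "motion A U nabla F I \<gamma> \<longleftrightarrow>
     smooth_curve A I \<gamma> \<and>
     (\<forall>t\<in>I. velocity A I \<gamma> t \<in> U) \<and>
     (\<forall>t\<in>I. covariant_derivative A nabla I \<gamma> (velocity A I \<gamma>) t = F (velocity A I \<gamma> t))"

definition dissipative_system :: "('m, 'n::finite) chart set \<Rightarrow> ('m, 'n) tvec set \<Rightarrow>
    (('m, 'n) tvec \<Rightarrow> real) \<Rightarrow> (('m, 'n) tvec \<Rightarrow> ('m, 'n) tvec) \<Rightarrow>
    ('m \<Rightarrow> real) \<Rightarrow> (('m, 'n) tvec \<Rightarrow> ('m, 'n) tvec) \<Rightarrow> bool" where
  "dissipative_system A U L F \<phi> Y \<longleftrightarrow>
     anisotropic_field A U F \<and> smooth_fun_on A UNIV \<phi> \<and> dissipative_field A U L Y \<and>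
     (\<forall>v\<in>U. F v = (-1) \<cdot>\<^sub>T anisotropic_gradient A L \<phi> v \<oplus>\<^sub>T Y v)"

definition total_energy :: "(('m, 'n) tvec \<Rightarrow> real) \<Rightarrow> ('m \<Rightarrow> real) \<Rightarrow> ('m, 'n) tvec \<Rightarrow> real" where
  "total_energy L \<phi> v = 1/2 * L v + \<phi> (fst v)"

end

theory Submission
  imports Defs
begin

text \<open>The derivative of the energy along a motion is \<open>g\<^sub>v(v, D\<^sub>\<gamma> v) + d\<phi>(v)\<close> with \<open>v = \<gamma>'\<close>, which equals
  \<open>g\<^sub>v(v, Y(v)) < 0\<close> because the gradient term cancels \<open>d\<phi>(v)\<close>. In a chart, Euler's identity gives
  \<open>g\<^sub>v(v, w) = \<partial>L/\<partial>y \<cdot> w / 2\<close>, so the claim for the kinetic part is that \<open>\<partial>L/\<partial>x \<cdot> v\<close> equals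
  \<open>\<partial>L/\<partial>y \<cdot> \<Gamma>(v)(v, v)\<close>. This is metric compatibility at the local field with constant
  components through \<open>v\<close>, whose Cartan term vanishes by homogeneity.\<close>

section \<open>Smooth maps on open sets\<close>

text \<open>Compatibility of the connection speaks about local vector fields, the equation of motion
  about a curve. Extending \<gamma>' to a field is avoided by proving an identity for each single
  \<open>v\<close> in \<open>U\<close>, for which any field through \<open>v\<close> may be chosen.
  Constant components in a chart are convenient twice over: the connection applied to such a field
  yields the Christoffel term alone, and L along it varies only through the base point. The second
  derivative of the coordinates of \<gamma> enters separately, by the chain rule. Apart from the
  nondegeneracy behind the gradient, the fundamental tensor occurs only with a multiple of its own
  base vector in one slot. Homogeneity turns each such value into a first derivative of L, in either
  order of the slots, and so takes the place of the symmetry of second derivatives. The computation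
  happens in a chart, at the times when the curve is inside it.\<close>

lemma frechet_derivative_at_eqI:
  "(f has_derivative f') (at x) \<Longrightarrow> frechet_derivative f (at x) w = f' w"
  using frechet_derivative_at by metis

text \<open>At a point of \<open>S\<close> both functions have the same derivatives within
  \<open>S\<close>, and \<open>frechet_derivative\<close> is a choice among these, so it is the same
  map even where derivatives are not unique. Hence \<open>S\<close> may be arbitrary, in particular
  a set of curve parameters.\<close>

lemma Ck_on_cong:
  assumes "\<And>x. x \<in> S \<Longrightarrow> f x = g x"
  shows "Ck_on k S f \<longleftrightarrow> Ck_on k S g"
  using assms
proof (induction k arbitrary: f g)
  case 0
  then show ?case by (auto cong: continuous_on_cong)
next
  case (Suc k)
  have D: "(f has_derivative f') (at x within S) \<longleftrightarrow> (g has_derivative f') (at x within S)"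
    if "x \<in> S" for x f'
    using has_derivative_transform[OF that] Suc.prems by metis
  have "frechet_derivative f (at x within S) = frechet_derivative g (at x within S)" if "x \<in> S" for x
    unfolding frechet_derivative_def using D[OF that] by simp
  then have "Ck_on k S (\<lambda>x. frechet_derivative f (at x within S) w) \<longleftrightarrow>
      Ck_on k S (\<lambda>x. frechet_derivative g (at x within S) w)" for w
    by (intro Suc.IH) simp
  moreover have "f differentiable_on S \<longleftrightarrow> g differentiable_on S"
    unfolding differentiable_on_def differentiable_def using D by blast
  ultimately show ?case by simp
qed

text \<open>On an open set derivatives are unique and do not depend on the restriction to
  \<open>S\<close>, so the chosen \<open>frechet_derivative\<close> can be exchanged for any
  explicit family of derivatives. The inductions on the order of smoothness rest on this.\<close>

lemma Ck_on_Suc_open: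
  assumes "open S"
  shows "Ck_on (Suc k) S f \<longleftrightarrow>
    (\<exists>f'. (\<forall>x\<in>S. (f has_derivative f' x) (at x)) \<and> (\<forall>w. Ck_on k S (\<lambda>x. f' x w)))"
proof
  assume f: "Ck_on (Suc k) S f"
  have "(f has_derivative frechet_derivative f (at x)) (at x)" if "x \<in> S" for x
  proof -
    have "f differentiable (at x)"
      using f that assms by (auto simp: differentiable_on_def at_within_open[OF that assms])
    then show ?thesis by (simp add: frechet_derivative_works)
  qed
  moreover have "Ck_on k S (\<lambda>x. frechet_derivative f (at x) w)" for w
    using f assms by (subst Ck_on_cong[where g = "\<lambda>x. frechet_derivative f (at x within S) w"])
      (auto simp: at_within_open[OF _ assms])
  ultimately show "\<exists>f'. (\<forall>x\<in>S. (f has_derivative f' x) (at x)) \<and> (\<forall>w. Ck_on k S (\<lambda>x. f' x w))"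
    by (intro exI[of _ "\<lambda>x. frechet_derivative f (at x)"]) simp
next
  assume "\<exists>f'. (\<forall>x\<in>S. (f has_derivative f' x) (at x)) \<and> (\<forall>w. Ck_on k S (\<lambda>x. f' x w))"
  then obtain f' where f': "\<And>x. x \<in> S \<Longrightarrow> (f has_derivative f' x) (at x)"
    and k: "\<And>w. Ck_on k S (\<lambda>x. f' x w)" by blast
  have "f differentiable_on S"
    using f' has_derivative_at_withinI unfolding differentiable_on_def differentiable_def by blast
  moreover have "Ck_on k S (\<lambda>x. frechet_derivative f (at x within S) w)" for w
    using k[of w] f' assms
    by (subst Ck_on_cong[where g = "\<lambda>x. f' x w"]) (auto simp: at_within_open[OF _ assms] frechet_derivative_at_eqI)
  ultimately show "Ck_on (Suc k) S f" by simp
qed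

lemma Ck_on_SucI:
  assumes "open S" "\<And>x. x \<in> S \<Longrightarrow> (f has_derivative f' x) (at x)"
    and "\<And>w. Ck_on k S (\<lambda>x. f' x w)"
  shows "Ck_on (Suc k) S f"
  unfolding Ck_on_Suc_open[OF assms(1)] using assms(2,3) by blast

lemma Ck_on_SucE:
  assumes "Ck_on (Suc k) S f" "open S"
  obtains f' where "\<And>x. x \<in> S \<Longrightarrow> (f has_derivative f' x) (at x)"
    and "\<And>w. Ck_on k S (\<lambda>x. f' x w)"
  using assms unfolding Ck_on_Suc_open[OF assms(2)] by blast

lemma Ck_on_SucD: "Ck_on (Suc k) S f \<Longrightarrow> Ck_on k S f"
  by (induction k arbitrary: f) (auto simp: differentiable_imp_continuous_on)

lemma Ck_on_subset:
  assumes "Ck_on k S f" "open S" "open T" "T \<subseteq> S"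
  shows "Ck_on k T f"
  using assms(1)
proof (induction k arbitrary: f)
  case 0
  then show ?case using assms(4) continuous_on_subset by auto
next
  case (Suc k)
  from Suc.prems assms(2) show ?case
    by (rule Ck_on_SucE) (use Suc.IH assms in \<open>blast intro: Ck_on_SucI\<close>)
qed

lemma Ck_on_const: "open S \<Longrightarrow> Ck_on k S (\<lambda>x. a)"
proof (induction k arbitrary: a)
  case (Suc k)
  then show ?case by (intro Ck_on_SucI[where f' = "\<lambda>x w. 0"]) auto
qed simp

lemma Ck_on_add:
  assumes "Ck_on k S f" "Ck_on k S g" "open S"
  shows "Ck_on k S (\<lambda>x. f x + g x)"
  using assms
proof (induction k arbitrary: f g)
  case 0
  then show ?case by (auto intro: continuous_on_add)
next
  case (Suc k)
  from Suc.prems(1,3) obtain f' where f': "\<And>x. x \<in> S \<Longrightarrow> (f has_derivative f' x) (at x)"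
    "\<And>w. Ck_on k S (\<lambda>x. f' x w)" by (rule Ck_on_SucE) blast
  from Suc.prems(2,3) obtain g' where g': "\<And>x. x \<in> S \<Longrightarrow> (g has_derivative g' x) (at x)"
    "\<And>w. Ck_on k S (\<lambda>x. g' x w)" by (rule Ck_on_SucE) blast
  show ?case
    using Suc f' g' by (intro Ck_on_SucI[where f' = "\<lambda>x w. f' x w + g' x w"] has_derivative_add) auto
qed

lemma Ck_on_sum:
  assumes "finite B" "\<And>b. b \<in> B \<Longrightarrow> Ck_on k S (f b)" "open S"
  shows "Ck_on k S (\<lambda>x. \<Sum>b\<in>B. f b x)"
  using assms by (induction B rule: finite_induct) (auto intro: Ck_on_const Ck_on_add)

lemma Ck_on_scaleR:
  assumes "Ck_on k S f" "Ck_on k S g" "open S"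
  shows "Ck_on k S (\<lambda>x. f x *\<^sub>R g x)"
  using assms
proof (induction k arbitrary: f g)
  case 0
  then show ?case by (auto intro: continuous_on_scaleR)
next
  case (Suc k)
  from Suc.prems(1,3) obtain f' where f': "\<And>x. x \<in> S \<Longrightarrow> (f has_derivative f' x) (at x)"
    "\<And>w. Ck_on k S (\<lambda>x. f' x w)" by (rule Ck_on_SucE) blast
  from Suc.prems(2,3) obtain g' where g': "\<And>x. x \<in> S \<Longrightarrow> (g has_derivative g' x) (at x)"
    "\<And>w. Ck_on k S (\<lambda>x. g' x w)" by (rule Ck_on_SucE) blast
  show ?case
    using Suc.prems f' g'
    by (intro Ck_on_SucI[where f' = "\<lambda>x w. f x *\<^sub>R g' x w + f' x w *\<^sub>R g x"]
        has_derivative_scaleR Ck_on_add Suc.IH) (auto dest: Ck_on_SucD simp del: Ck_on.simps)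
qed

lemma Ck_on_bounded_linear:
  assumes "Ck_on k S f" "open S" "bounded_linear h"
  shows "Ck_on k S (\<lambda>x. h (f x))"
  using assms
proof (induction k arbitrary: f)
  case 0
  then show ?case by (auto intro: bounded_linear.continuous_on)
next
  case (Suc k)
  from Suc.prems(1,2) obtain f' where f': "\<And>x. x \<in> S \<Longrightarrow> (f has_derivative f' x) (at x)"
    "\<And>w. Ck_on k S (\<lambda>x. f' x w)" by (rule Ck_on_SucE) blast
  have "Ck_on k S (\<lambda>x. h (f' x w))" for w
    using Suc.IH[OF f'(2) Suc.prems(2,3)] .
  then show ?case
    using bounded_linear.has_derivative[OF Suc.prems(3) f'(1)] Suc.prems(2) by (rule_tac Ck_on_SucI)
qed

text \<open>\<open>Ck_on\<close> controls derivatives in fixed directions only, whereas the chain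
  rule evaluates \<open>g'\<close> in the moving direction \<open>f' x w\<close>. Expanding that
  direction in \<open>Basis\<close> leaves fixed directions with scalar coefficients, which the
  induction hypothesis and the product rule can handle.\<close>

lemma Ck_on_compose:
  fixes g :: "'b::euclidean_space \<Rightarrow> 'c::real_normed_vector"
  assumes "Ck_on k S f" "Ck_on k T g" "open S" "open T" "f ` S \<subseteq> T"
  shows "Ck_on k S (\<lambda>x. g (f x))"
  using assms
proof (induction k arbitrary: f g)
  case 0
  then show ?case by (auto intro: continuous_on_compose2)
next
  case (Suc k)
  from Suc.prems(1,3) obtain f' where f': "\<And>x. x \<in> S \<Longrightarrow> (f has_derivative f' x) (at x)"
    "\<And>w. Ck_on k S (\<lambda>x. f' x w)" by (rule Ck_on_SucE) blast
  from Suc.prems(2,4) obtain g' where g': "\<And>x. x \<in> T \<Longrightarrow> (g has_derivative g' x) (at x)"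
    "\<And>w. Ck_on k T (\<lambda>x. g' x w)" by (rule Ck_on_SucE) blast
  have "g' (f x) (f' x w) = (\<Sum>b\<in>Basis. (f' x w \<bullet> b) *\<^sub>R g' (f x) b)" if "x \<in> S" for x w
  proof -
    have lin: "linear (g' (f x))"
      using g'(1) that Suc.prems(5) has_derivative_linear by blast
    have "g' (f x) (f' x w) = g' (f x) (\<Sum>b\<in>Basis. (f' x w \<bullet> b) *\<^sub>R b)"
      by (simp add: euclidean_representation)
    then show ?thesis by (simp add: linear_sum[OF lin] linear_cmul[OF lin])
  qed
  moreover have "Ck_on k S (\<lambda>x. \<Sum>b\<in>Basis. (f' x w \<bullet> b) *\<^sub>R g' (f x) b)" for w
  proof (intro Ck_on_sum Ck_on_scaleR Suc.prems)
    fix b :: 'b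
    show "Ck_on k S (\<lambda>x. f' x w \<bullet> b)"
      by (intro Ck_on_bounded_linear[OF f'(2)] Suc.prems bounded_linear_inner_left)
    show "Ck_on k S (\<lambda>x. g' (f x) b)"
      by (intro Suc.IH Ck_on_SucD[OF Suc.prems(1)] g' Suc.prems)
  qed auto
  ultimately have "Ck_on k S (\<lambda>x. g' (f x) (f' x w))" for w
    by (subst Ck_on_cong) auto
  moreover have "((\<lambda>x. g (f x)) has_derivative (\<lambda>w. g' (f x) (f' x w))) (at x)" if "x \<in> S" for x
    using has_derivative_compose[OF f'(1)[OF that] g'(1)] that Suc.prems(5) by blast
  ultimately show ?case by (intro Ck_on_SucI Suc.prems)
qed

section \<open>Tangent vectors in charts\<close>

context
  fixes A :: "('m::topological_space, 'n::finite) chart set"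
  assumes atlas: "smooth_atlas A"
begin

lemma chart_homeomorphism: "c \<in> A \<Longrightarrow> homeomorphism (fst c) (snd c ` fst c) (snd c) (chart_inv c)"
  and chart_open: "c \<in> A \<Longrightarrow> open (fst c)"
  and chart_cover: "\<exists>c\<in>A. p \<in> fst c"
  using atlas by (auto simp: smooth_atlas_def)

lemma chart_inv_chart [simp]: "c \<in> A \<Longrightarrow> p \<in> fst c \<Longrightarrow> chart_inv c (snd c p) = p"
  using homeomorphism_apply1[OF chart_homeomorphism] .

lemma chart_image_open:
  assumes "c \<in> A" "open \<Omega>"
  shows "open (snd c ` (fst c \<inter> \<Omega>))"
proof -
  have "openin (top_of_set (snd c ` fst c)) (snd c ` (fst c \<inter> \<Omega>))"
    using assms by (intro homeomorphism_imp_open_map[OF chart_homeomorphism]) (auto simp: openin_open)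
  moreover have "open (snd c ` fst c)"
    using atlas assms by (auto simp: smooth_atlas_def)
  ultimately show ?thesis by (simp add: openin_open_eq)
qed

lemma transition_chart [simp]: "c \<in> A \<Longrightarrow> p \<in> fst c \<Longrightarrow> transition c c' (snd c p) = snd c' p"
  by (simp add: transition_def)

lemma transition_smooth:
  "c \<in> A \<Longrightarrow> c' \<in> A \<Longrightarrow> Ck_on k (snd c ` (fst c \<inter> fst c')) (transition c c')"
  using atlas by (auto simp: smooth_atlas_def smooth_map_on_def)

lemma transition_has_derivative:
  assumes "c \<in> A" "c' \<in> A" "p \<in> fst c" "p \<in> fst c'"
  shows "(transition c c' has_derivative frechet_derivative (transition c c') (at (snd c p)))
    (at (snd c p))"
proof -
  have "Ck_on (Suc 0) (snd c ` (fst c \<inter> fst c')) (transition c c')"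
    using assms by (intro transition_smooth)
  then have "(transition c c') differentiable (at (snd c p))"
    by (rule Ck_on_SucE)
      (use assms in \<open>auto simp: differentiable_def intro: chart_image_open chart_open\<close>)
  then show ?thesis by (simp add: frechet_derivative_works)
qed

lemma transition_cocycle:
  assumes "c \<in> A" "c' \<in> A" "c'' \<in> A" "p \<in> fst c" "p \<in> fst c'" "p \<in> fst c''"
  shows "frechet_derivative (transition c c'') (at (snd c p)) a =
    frechet_derivative (transition c' c'') (at (snd c' p))
      (frechet_derivative (transition c c') (at (snd c p)) a)"
proof -
  have "((\<lambda>x. transition c' c'' (transition c c' x)) has_derivative
      (\<lambda>a. frechet_derivative (transition c' c'') (at (snd c' p))
        (frechet_derivative (transition c c') (at (snd c p)) a))) (at (snd c p))"
    using assms transition_has_derivative[of c' c'' p]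
    by (intro has_derivative_compose[OF transition_has_derivative]) auto
  \<comment> \<open>The composition law for transition maps holds only over the overlap of all three
    charts; its image is an open neighbourhood of \<open>snd c p\<close>, which is enough for the
    derivative there.\<close>
  then have "(transition c c'' has_derivative
      (\<lambda>a. frechet_derivative (transition c' c'') (at (snd c' p))
        (frechet_derivative (transition c c') (at (snd c p)) a))) (at (snd c p))"
    by (rule has_derivative_transform_within_open[where s = "snd c ` (fst c \<inter> (fst c' \<inter> fst c''))"])
      (use assms in \<open>auto intro: chart_image_open chart_open\<close>)
  then show ?thesis by (rule frechet_derivative_at_eqI)
qed

lemma transition_self:
  assumes "c \<in> A" "p \<in> fst c"
  shows "frechet_derivative (transition c c) (at (snd c p)) a = a"
proof -
  have "((\<lambda>x. x) has_derivative (\<lambda>a. a)) (at (snd c p))" by simp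
  then have "(transition c c has_derivative (\<lambda>a. a)) (at (snd c p))"
    by (rule has_derivative_transform_within_open[where s = "snd c ` (fst c \<inter> UNIV)"])
      (use assms in \<open>auto intro: chart_image_open[of c UNIV, simplified]\<close>)
  then show ?thesis by (rule frechet_derivative_at_eqI)
qed

text \<open>The inverse of reading off components in \<open>c\<close>: the Jacobians force the
  components in the other charts around \<open>p\<close>, and 0 elsewhere is the normalisation made
  in \<open>tangent_space\<close>.\<close>

definition tvec_of :: "('m, 'n) chart \<Rightarrow> 'm \<Rightarrow> real ^ 'n \<Rightarrow> ('m, 'n) tvec" where
  "tvec_of c p a = (p, \<lambda>c'. if c' \<in> A \<and> p \<in> fst c'
     then frechet_derivative (transition c c') (at (snd c p)) a else 0)"

lemma fst_tvec_of [simp]: "fst (tvec_of c p a) = p"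
  by (simp add: tvec_of_def)

lemma snd_tvec_of:
  "c' \<in> A \<Longrightarrow> p \<in> fst c' \<Longrightarrow>
    snd (tvec_of c p a) c' = frechet_derivative (transition c c') (at (snd c p)) a"
  by (simp add: tvec_of_def)

lemma snd_tvec_of_self [simp]: "c \<in> A \<Longrightarrow> p \<in> fst c \<Longrightarrow> snd (tvec_of c p a) c = a"
  by (simp add: tvec_of_def transition_self)

lemma tvec_of_in_tangent_space [simp]:
  "c \<in> A \<Longrightarrow> p \<in> fst c \<Longrightarrow> tvec_of c p a \<in> tangent_space A p"
  by (auto simp: tangent_space_def tvec_of_def intro: transition_cocycle)

lemma tangent_space_fst: "v \<in> tangent_space A p \<Longrightarrow> fst v = p"
  by (simp add: tangent_space_def)

lemma tangent_space_snd:
  assumes "v \<in> tangent_space A p"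
  shows "c \<in> A \<Longrightarrow> c' \<in> A \<Longrightarrow> p \<in> fst c \<Longrightarrow> p \<in> fst c' \<Longrightarrow>
      snd v c' = frechet_derivative (transition c c') (at (snd c p)) (snd v c)"
    and "c \<notin> A \<or> p \<notin> fst c \<Longrightarrow> snd v c = 0"
  using assms unfolding tangent_space_def by blast+

lemma tvec_of_snd:
  assumes "v \<in> tangent_space A p" "c \<in> A" "p \<in> fst c"
  shows "tvec_of c p (snd v c) = v"
proof (rule prod_eqI)
  show "snd (tvec_of c p (snd v c)) = snd v"
  proof
    fix c'
    show "snd (tvec_of c p (snd v c)) c' = snd v c'"
      using tangent_space_snd(1)[OF assms(1), of c c'] tangent_space_snd(2)[OF assms(1), of c'] assms(2,3)
      by (auto simp: tvec_of_def)
  qed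
qed (use assms in \<open>simp add: tangent_space_fst\<close>)

lemma tangent_space_eqI:
  assumes "v \<in> tangent_space A p" "w \<in> tangent_space A p" "c \<in> A" "p \<in> fst c" "snd v c = snd w c"
  shows "v = w"
  using assms tvec_of_snd by metis

lemma tvec_of_add:
  assumes "c \<in> A" "p \<in> fst c"
  shows "tvec_of c p (a + b) = tvec_of c p a \<oplus>\<^sub>T tvec_of c p b"
  using assms linear_add[OF has_derivative_linear[OF transition_has_derivative]]
  by (auto simp: tvec_of_def tadd_def fun_eq_iff)

lemma tvec_of_scale:
  assumes "c \<in> A" "p \<in> fst c"
  shows "tvec_of c p (r *\<^sub>R a) = r \<cdot>\<^sub>T tvec_of c p a"
  using assms linear_cmul[OF has_derivative_linear[OF transition_has_derivative]]
  by (auto simp: tvec_of_def tscale_def fun_eq_iff)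

lemma bundle_chart_inv_bundle_chart:
  assumes "v \<in> tangent_space A p" "c \<in> A" "p \<in> fst c"
  shows "bundle_chart_inv A c (bundle_chart c v) = v"
  unfolding bundle_chart_inv_def
proof (rule inv_into_f_f)
  show "inj_on (bundle_chart c) {v \<in> tangent_bundle A. fst v \<in> fst c}"
  proof (rule inj_onI)
    fix v w assume vw: "v \<in> {v \<in> tangent_bundle A. fst v \<in> fst c}"
      "w \<in> {v \<in> tangent_bundle A. fst v \<in> fst c}" "bundle_chart c v = bundle_chart c w"
    then have "fst v = fst w"
      using assms(2) by (metis (mono_tags, lifting) Pair_inject bundle_chart_def chart_inv_chart mem_Collect_eq)
    then show "v = w"
      using vw assms(2)
      by (intro tangent_space_eqI[where p = "fst v" and c = c])
        (auto simp: tangent_bundle_def bundle_chart_def tangent_space_fst)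
  qed
qed (use assms in \<open>auto simp: tangent_bundle_def tangent_space_fst\<close>)

lemma bundle_chart_inv_eq:
  assumes "c \<in> A" "p \<in> fst c"
  shows "bundle_chart_inv A c (snd c p, a) = tvec_of c p a"
  using bundle_chart_inv_bundle_chart[OF tvec_of_in_tangent_space[OF assms] assms, of a] assms
  by (simp add: bundle_chart_def)

lemma bundle_chart_image_iff:
  assumes "U \<subseteq> tangent_bundle A" "c \<in> A" "p \<in> fst c"
  shows "(snd c p, a) \<in> bundle_chart_image c U \<longleftrightarrow> tvec_of c p a \<in> U"
proof
  assume "(snd c p, a) \<in> bundle_chart_image c U"
  then obtain v where v: "v \<in> U" "fst v \<in> fst c" "bundle_chart c v = (snd c p, a)"
    by (auto simp: bundle_chart_image_def)
  have "v \<in> tangent_space A (fst v)"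
    using v(1) assms(1) by (auto simp: tangent_bundle_def tangent_space_fst)
  then have "v = tvec_of c p a"
    using bundle_chart_inv_bundle_chart[of v _ c] bundle_chart_inv_eq[OF assms(2,3)] v assms(2) by metis
  then show "tvec_of c p a \<in> U" using v by simp
next
  assume "tvec_of c p a \<in> U"
  then show "(snd c p, a) \<in> bundle_chart_image c U"
    using assms by (auto simp: bundle_chart_image_def bundle_chart_def intro!: rev_image_eqI)
qed

text \<open>These are the coordinate fields of \<open>c\<close> and their constant linear
  combinations. In another chart \<open>c'\<close> the components are the Jacobian of the transition
  from \<open>c\<close>, evaluated along the transition from \<open>c'\<close> to \<open>c\<close>.
  One order of smoothness is spent on the Jacobian, so order \<open>k\<close> uses order
  \<open>Suc k\<close> of the transition map.\<close>

lemma vector_field_constant_components: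
  assumes "c \<in> A" "open \<Omega>" "\<Omega> \<subseteq> fst c"
  shows "vector_field_on A \<Omega> (\<lambda>p. bundle_chart_inv A c (snd c p, a))"
  unfolding vector_field_on_def
proof (intro conjI ballI)
  fix p assume "p \<in> \<Omega>"
  then show "bundle_chart_inv A c (snd c p, a) \<in> tangent_space A p"
    using assms by (auto simp: bundle_chart_inv_eq subset_iff)
next
  fix c' assume c': "c' \<in> A"
  let ?S = "snd c' ` (fst c' \<inter> \<Omega>)" and ?T = "snd c ` (fst c \<inter> fst c')"
  have op: "open ?S" "open ?T"
    using assms c' by (auto intro: chart_image_open chart_open)
  show "smooth_map_on ?S (\<lambda>x. snd (bundle_chart_inv A c (snd c (chart_inv c' x), a)) c')"
    unfolding smooth_map_on_def
  proof
    fix k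
    have "Ck_on k ?T (\<lambda>x. frechet_derivative (transition c c') (at x within ?T) a)"
      using transition_smooth[OF assms(1) c', of "Suc k"] by simp
    then have "Ck_on k ?T (\<lambda>x. frechet_derivative (transition c c') (at x) a)"
      by (rule Ck_on_cong[THEN iffD1, rotated]) (simp add: at_within_open[OF _ op(2)])
    moreover have "Ck_on k ?S (transition c' c)"
      by (rule Ck_on_subset[OF transition_smooth[OF c' assms(1)]])
        (use op assms c' in \<open>auto intro: chart_image_open chart_open\<close>)
    moreover have "transition c' c ` ?S \<subseteq> ?T"
      using assms(3) c' by auto
    ultimately have comp: "Ck_on k ?S (\<lambda>x. frechet_derivative (transition c c') (at (transition c' c x)) a)"
      using op by (rule_tac Ck_on_compose)
    have "frechet_derivative (transition c c') (at (transition c' c x)) a =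
        snd (bundle_chart_inv A c (snd c (chart_inv c' x), a)) c'" if "x \<in> ?S" for x
    proof -
      from that obtain q where "q \<in> fst c'" "q \<in> \<Omega>" "x = snd c' q" by blast
      then show ?thesis
        using assms(1,3) c' by (simp add: bundle_chart_inv_eq snd_tvec_of subset_iff)
    qed
    from Ck_on_cong[THEN iffD1, OF this comp]
    show "Ck_on k ?S (\<lambda>x. snd (bundle_chart_inv A c (snd c (chart_inv c' x), a)) c')" .
  qed
qed

text \<open>The chain rule through the transition map compensates for the arbitrary chart that
  \<open>differential\<close> picks, so that any convenient chart can be used.\<close>

lemma differential_eq:
  assumes "c \<in> A" "p \<in> fst c" "w \<in> tangent_space A p"
    and f: "(f \<circ> chart_inv c has_derivative f') (at (snd c p))"
  shows "differential A f w = f' (snd w c)"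
proof -
  define c0 where "c0 = (SOME c. c \<in> A \<and> fst w \<in> fst c)"
  have "\<exists>c. c \<in> A \<and> fst w \<in> fst c" using chart_cover by blast
  then have "c0 \<in> A \<and> fst w \<in> fst c0" unfolding c0_def by (rule someI_ex)
  then have c0: "c0 \<in> A" "p \<in> fst c0" using tangent_space_fst[OF assms(3)] by auto
  have "((\<lambda>x. (f \<circ> chart_inv c) (transition c0 c x)) has_derivative
      (\<lambda>a. f' (frechet_derivative (transition c0 c) (at (snd c0 p)) a))) (at (snd c0 p))"
    using f assms(1,2) c0 by (intro has_derivative_compose[OF transition_has_derivative]) (simp_all del: o_apply)
  then have "(f \<circ> chart_inv c0 has_derivative
      (\<lambda>a. f' (frechet_derivative (transition c0 c) (at (snd c0 p)) a))) (at (snd c0 p))"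
    by (rule has_derivative_transform_within_open[where s = "snd c0 ` (fst c0 \<inter> fst c)"])
      (use assms c0 in \<open>auto intro: chart_image_open chart_open\<close>)
  then have "differential A f w = f' (frechet_derivative (transition c0 c) (at (snd c0 p)) (snd w c0))"
    using tangent_space_fst[OF assms(3)] unfolding differential_def Let_def c0_def[symmetric]
    by (simp add: frechet_derivative_at_eqI)
  also have "frechet_derivative (transition c0 c) (at (snd c0 p)) (snd w c0) = snd w c"
    using tangent_space_snd(1)[OF assms(3) c0(1) assms(1) c0(2) assms(2)] by simp
  finally show ?thesis .
qed

end

section \<open>Derivatives of functions homogeneous in the fibre\<close>

lemma has_derivative_along_line:
  assumes "(f has_derivative f') (at z)"
  shows "((\<lambda>t. f (z + t *\<^sub>R a)) has_vector_derivative f' a) (at 0)"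
proof -
  have "((\<lambda>t. z + t *\<^sub>R a) has_derivative (\<lambda>t. t *\<^sub>R a)) (at 0)"
    by (auto intro!: derivative_eq_intros)
  from has_derivative_compose[OF this, of f f'] assms
  have "((\<lambda>t. f (z + t *\<^sub>R a)) has_derivative (\<lambda>t. f' (t *\<^sub>R a))) (at 0)" by simp
  then show ?thesis
    by (simp add: has_vector_derivative_def linear_cmul[OF has_derivative_linear[OF assms]])
qed

lemma has_field_derivative_along_line:
  fixes f :: "'a::real_normed_vector \<Rightarrow> real"
  assumes "(f has_derivative f') (at z)"
  shows "((\<lambda>t. f (z + t *\<^sub>R a)) has_real_derivative f' a) (at 0)"
  using has_derivative_along_line[OF assms] by (simp add: has_real_derivative_iff_has_vector_derivative)

lemma eventually_along_line:
  fixes z a :: "'a::real_normed_vector"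
  assumes "open W" "z \<in> W"
  shows "eventually (\<lambda>t. z + t *\<^sub>R a \<in> W) (nhds (0::real))"
proof -
  have "open ((\<lambda>t. z + t *\<^sub>R a) -` W)"
    using assms(1) by (intro open_vimage) (auto intro!: continuous_intros)
  moreover have "0 \<in> (\<lambda>t. z + t *\<^sub>R a) -` W" using assms(2) by simp
  ultimately show ?thesis using eventually_nhds_in_open by fastforce
qed

text \<open>The pattern behind the homogeneity identities below: one function of a real parameter is
  differentiated at 0 directly and again after rewriting it by homogeneity. The rewriting is valid
  only while the argument stays in the domain, hence the equality near \<open>x\<close>.\<close>

lemma DERIV_unique_ev:
  fixes f g :: "real \<Rightarrow> real"
  assumes "(f has_real_derivative d) (at x)" "eventually (\<lambda>t. f t = g t) (nhds x)"
    and "(g has_real_derivative e) (at x)"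
  shows "d = e"
  using assms DERIV_cong_ev[OF refl assms(2) refl] DERIV_unique by blast

lemma linear_axis_expansion:
  fixes h :: "real ^ 'n \<Rightarrow> 'b::real_vector"
  assumes "linear h"
  shows "h a = (\<Sum>i\<in>UNIV. (a $ i) *\<^sub>R h (axis i 1))"
proof -
  have "h a = h (\<Sum>i\<in>UNIV. (a $ i) *\<^sub>R axis i 1)"
    by (simp add: basis_expansion flip: scalar_mult_eq_scaleR)
  then show ?thesis by (simp add: linear_sum[OF assms] linear_cmul[OF assms])
qed

definition deriv1 :: "('e::real_normed_vector \<Rightarrow> real) \<Rightarrow> 'e \<Rightarrow> 'e \<Rightarrow> real" where
  "deriv1 l z b = frechet_derivative l (at z) b"

text \<open>The direction \<open>b\<close> is differentiated first and \<open>a\<close> second, in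
  agreement with the inner and outer \<open>deriv\<close> in \<open>fundamental_tensor\<close>. The
  two orders are kept apart throughout.\<close>

definition deriv2 :: "('e::real_normed_vector \<Rightarrow> real) \<Rightarrow> 'e \<Rightarrow> 'e \<Rightarrow> 'e \<Rightarrow> real" where
  "deriv2 l z a b = frechet_derivative (\<lambda>z. deriv1 l z b) (at z) a"

context
  fixes l :: "'e::real_normed_vector \<Rightarrow> real" and W :: "'e set"
  assumes W: "open W" and l: "smooth_map_on W l"
begin

lemma deriv1: "z \<in> W \<Longrightarrow> (l has_derivative deriv1 l z) (at z)"
  and deriv2: "z \<in> W \<Longrightarrow> ((\<lambda>z. deriv1 l z b) has_derivative (\<lambda>a. deriv2 l z a b)) (at z)"
proof -
  have "Ck_on (Suc (Suc 0)) W l" using l by (auto simp: smooth_map_on_def)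
  then obtain l' where l': "\<And>z. z \<in> W \<Longrightarrow> (l has_derivative l' z) (at z)"
    and l'': "\<And>b. Ck_on (Suc 0) W (\<lambda>z. l' z b)" using W by (rule Ck_on_SucE) blast
  have d1: "deriv1 l z = l' z" if "z \<in> W" for z
    using frechet_derivative_at_eqI[OF l'[OF that]] by (auto simp: deriv1_def)
  then show "(l has_derivative deriv1 l z) (at z)" if "z \<in> W" using l' that by simp
  show "((\<lambda>z. deriv1 l z b) has_derivative (\<lambda>a. deriv2 l z a b)) (at z)" if "z \<in> W"
  proof -
    from l''[of b] W obtain m where "\<And>z. z \<in> W \<Longrightarrow> ((\<lambda>z. l' z b) has_derivative m z) (at z)"
      by (rule Ck_on_SucE) blast
    then have "((\<lambda>z. l' z b) has_derivative m z) (at z)" using that .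
    then have "((\<lambda>z. deriv1 l z b) has_derivative m z) (at z)"
      by (rule has_derivative_transform_within_open[OF _ W that]) (simp add: d1)
    with frechet_derivative_at_eqI[OF this] show ?thesis by (simp add: deriv2_def)
  qed
qed

lemma deriv1_linear: "z \<in> W \<Longrightarrow> linear (deriv1 l z)"
  using deriv1 has_derivative_linear by blast

lemma deriv2_linear1: "z \<in> W \<Longrightarrow> linear (\<lambda>a. deriv2 l z a b)"
  using deriv2 has_derivative_linear by blast

text \<open>Linearity in \<open>a\<close> belongs to every derivative. Linearity in \<open>b\<close>
  comes from differentiating the linearity of \<open>deriv1\<close> in its direction, an identity
  that holds on the whole open set \<open>W\<close>.\<close>

lemma deriv2_linear2:
  assumes "z \<in> W"
  shows "linear (deriv2 l z a)"
proof (rule linearI)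
  fix b b' and r :: real
  have "((\<lambda>z. deriv1 l z b + deriv1 l z b') has_derivative (\<lambda>a. deriv2 l z a b + deriv2 l z a b')) (at z)"
    by (intro has_derivative_add deriv2 assms)
  then have "((\<lambda>z. deriv1 l z (b + b')) has_derivative (\<lambda>a. deriv2 l z a b + deriv2 l z a b')) (at z)"
    by (rule has_derivative_transform_within_open[OF _ W assms]) (simp add: linear_add[OF deriv1_linear])
  from fun_cong[OF has_derivative_unique[OF this deriv2[OF assms]], of a]
  show "deriv2 l z a (b + b') = deriv2 l z a b + deriv2 l z a b'" by simp
  have "((\<lambda>z. r *\<^sub>R deriv1 l z b) has_derivative (\<lambda>a. r *\<^sub>R deriv2 l z a b)) (at z)"
    by (intro has_derivative_scaleR_right deriv2 assms)
  then have "((\<lambda>z. deriv1 l z (r *\<^sub>R b)) has_derivative (\<lambda>a. r *\<^sub>R deriv2 l z a b)) (at z)"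
    by (rule has_derivative_transform_within_open[OF _ W assms]) (simp add: linear_cmul[OF deriv1_linear])
  from fun_cong[OF has_derivative_unique[OF this deriv2[OF assms]], of a]
  show "deriv2 l z a (r *\<^sub>R b) = r *\<^sub>R deriv2 l z a b" by simp
qed

lemma deriv_deriv_eq_deriv2:
  assumes "z \<in> W"
  shows "deriv (\<lambda>t. deriv (\<lambda>s. l (z + t *\<^sub>R a + s *\<^sub>R b)) 0) 0 = deriv2 l z a b"
proof -
  have "deriv (\<lambda>s. l (z + t *\<^sub>R a + s *\<^sub>R b)) 0 = deriv1 l (z + t *\<^sub>R a) b" if "z + t *\<^sub>R a \<in> W" for t
    using has_field_derivative_along_line[OF deriv1[OF that]] by (rule DERIV_imp_deriv)
  then have "eventually (\<lambda>t. deriv (\<lambda>s. l (z + t *\<^sub>R a + s *\<^sub>R b)) 0 = deriv1 l (z + t *\<^sub>R a) b) (nhds 0)"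
    using eventually_along_line[OF W assms, of a] by (auto elim: eventually_mono)
  then have "deriv (\<lambda>t. deriv (\<lambda>s. l (z + t *\<^sub>R a + s *\<^sub>R b)) 0) 0 = deriv (\<lambda>t. deriv1 l (z + t *\<^sub>R a) b) 0"
    by (intro deriv_cong_ev) auto
  also have "\<dots> = deriv2 l z a b"
    using has_field_derivative_along_line[OF deriv2[OF assms]] by (rule DERIV_imp_deriv)
  finally show ?thesis .
qed

end

context
  fixes l :: "'a::real_normed_vector \<times> 'b::real_normed_vector \<Rightarrow> real" and W :: "('a \<times> 'b) set"
  assumes W: "open W" and l: "smooth_map_on W l"
    and conic: "\<And>x y r. (x, y) \<in> W \<Longrightarrow> r > 0 \<Longrightarrow> (x, r *\<^sub>R y) \<in> W"
    and homogeneous: "\<And>x y r. (x, y) \<in> W \<Longrightarrow> r > 0 \<Longrightarrow> l (x, r *\<^sub>R y) = r\<^sup>2 * l (x, y)"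
begin

lemma eventually_radial:
  "eventually (\<lambda>t. (x, y) + t *\<^sub>R (0, y) = (x, (1 + t) *\<^sub>R y) \<and> 1 + t > 0) (nhds (0::real))"
proof -
  have "eventually (\<lambda>t::real. t \<in> {-1<..}) (nhds 0)"
    by (rule eventually_nhds_in_open) auto
  then show ?thesis by eventually_elim (simp add: algebra_simps)
qed

lemma euler_deriv1:
  assumes "(x, y) \<in> W"
  shows "deriv1 l (x, y) (0, y) = 2 * l (x, y)"
proof -
  have "((\<lambda>t. l ((x, y) + t *\<^sub>R (0, y))) has_real_derivative deriv1 l (x, y) (0, y)) (at 0)"
    by (intro has_field_derivative_along_line deriv1[OF W l] assms)
  moreover have "eventually (\<lambda>t. l ((x, y) + t *\<^sub>R (0, y)) = (1 + t)\<^sup>2 * l (x, y)) (nhds 0)"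
    using eventually_radial[of x y] by eventually_elim (simp only: homogeneous assms)
  moreover have "((\<lambda>t. (1 + t)\<^sup>2 * l (x, y)) has_real_derivative 2 * l (x, y)) (at 0)"
    by (auto intro!: derivative_eq_intros)
  ultimately show ?thesis by (rule DERIV_unique_ev)
qed

text \<open>Scaling the direction together with the point produces \<open>r\<^sup>2\<close> by
  homogeneity of \<open>l\<close>, while linearity in the direction accounts for one factor
  \<open>r\<close>; dividing by it leaves degree one.\<close>

lemma deriv1_homogeneous:
  assumes "(x, y) \<in> W" "r > 0"
  shows "deriv1 l (x, r *\<^sub>R y) (0, w) = r * deriv1 l (x, y) (0, w)"
proof -
  have "((\<lambda>t. l ((x, r *\<^sub>R y) + t *\<^sub>R (0, r *\<^sub>R w))) has_real_derivative
      deriv1 l (x, r *\<^sub>R y) (0, r *\<^sub>R w)) (at 0)"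
    by (intro has_field_derivative_along_line deriv1[OF W l] conic assms)
  moreover have "eventually (\<lambda>t. l ((x, r *\<^sub>R y) + t *\<^sub>R (0, r *\<^sub>R w)) =
      r\<^sup>2 * l ((x, y) + t *\<^sub>R (0, w))) (nhds 0)"
    using eventually_along_line[OF W assms(1), of "(0, w)"]
  proof eventually_elim
    case (elim t)
    then show ?case
      using homogeneous[of x "y + t *\<^sub>R w" r] assms(2) by (simp add: algebra_simps)
  qed
  moreover have "((\<lambda>t. r\<^sup>2 * l ((x, y) + t *\<^sub>R (0, w))) has_real_derivative
      r\<^sup>2 * deriv1 l (x, y) (0, w)) (at 0)"
    by (intro DERIV_cmult has_field_derivative_along_line deriv1[OF W l] assms)
  ultimately have "deriv1 l (x, r *\<^sub>R y) (0, r *\<^sub>R w) = r\<^sup>2 * deriv1 l (x, y) (0, w)"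
    by (rule DERIV_unique_ev)
  then show ?thesis
    using assms(2) linear_cmul[OF deriv1_linear[OF W l conic[OF assms]], of r "(0, w)"]
    by (simp add: power2_eq_square)
qed

text \<open>Euler's identity for \<open>deriv1\<close> in the fixed direction \<open>(0, w)\<close>,
  which is homogeneous of degree one in the fibre.\<close>

lemma deriv2_radial_left:
  assumes "(x, y) \<in> W"
  shows "deriv2 l (x, y) (0, y) (0, w) = deriv1 l (x, y) (0, w)"
proof -
  have "((\<lambda>t. deriv1 l ((x, y) + t *\<^sub>R (0, y)) (0, w)) has_real_derivative
      deriv2 l (x, y) (0, y) (0, w)) (at 0)"
    by (intro has_field_derivative_along_line deriv2[OF W l] assms)
  moreover have "eventually (\<lambda>t. deriv1 l ((x, y) + t *\<^sub>R (0, y)) (0, w) =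
      (1 + t) * deriv1 l (x, y) (0, w)) (nhds 0)"
    using eventually_radial[of x y] by eventually_elim (simp only: deriv1_homogeneous assms)
  moreover have "((\<lambda>t. (1 + t) * deriv1 l (x, y) (0, w)) has_real_derivative deriv1 l (x, y) (0, w)) (at 0)"
    by (auto intro!: derivative_eq_intros)
  ultimately show ?thesis by (rule DERIV_unique_ev)
qed

text \<open>Differentiating Euler's identity in the fibre direction \<open>w\<close> gives the swapped order without
  appealing to the symmetry of second derivatives.\<close>

lemma deriv2_radial_right:
  assumes "(x, y) \<in> W"
  shows "deriv2 l (x, y) (0, w) (0, y) = deriv1 l (x, y) (0, w)"
proof -
  let ?z = "\<lambda>t. (x, y) + t *\<^sub>R (0, w)"
  have 1: "((\<lambda>t. deriv1 l (?z t) (0, y)) has_real_derivative deriv2 l (x, y) (0, w) (0, y)) (at 0)"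
    by (intro has_field_derivative_along_line deriv2[OF W l] assms)
  \<comment> \<open>Euler's identity at \<open>?z t\<close> has the moving direction
    \<open>(0, y + t *\<^sub>R w)\<close>. This term makes up the difference to the fixed direction
    \<open>(0, y)\<close>; because of the factor \<open>t\<close>, its derivative at 0 is just
    \<open>deriv1 l (x, y) (0, w)\<close>.\<close>
  have "((\<lambda>t. t * deriv1 l (?z t) (0, w)) has_real_derivative
      0 * deriv2 l (x, y) (0, w) (0, w) + 1 * deriv1 l (?z 0) (0, w)) (at 0)"
    by (intro DERIV_mult' DERIV_ident has_field_derivative_along_line deriv2[OF W l] assms)
  from DERIV_add[OF 1 this]
  have "((\<lambda>t. deriv1 l (?z t) (0, y) + t * deriv1 l (?z t) (0, w)) has_real_derivative
      deriv2 l (x, y) (0, w) (0, y) + deriv1 l (x, y) (0, w)) (at 0)"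
    by simp
  moreover have "eventually (\<lambda>t. deriv1 l (?z t) (0, y) + t * deriv1 l (?z t) (0, w) = 2 * l (?z t)) (nhds 0)"
    using eventually_along_line[OF W assms, of "(0, w)"]
  proof eventually_elim
    case (elim t)
    have "deriv1 l (?z t) (0, y) + t * deriv1 l (?z t) (0, w) = deriv1 l (?z t) ((0, y) + t *\<^sub>R (0, w))"
      by (simp only: linear_add[OF deriv1_linear[OF W l elim]]
          linear_cmul[OF deriv1_linear[OF W l elim]] real_scaleR_def)
    then show ?case using euler_deriv1[of x "y + t *\<^sub>R w"] elim by simp
  qed
  moreover have "((\<lambda>t. 2 * l (?z t)) has_real_derivative 2 * deriv1 l (x, y) (0, w)) (at 0)"
    by (intro DERIV_cmult has_field_derivative_along_line deriv1[OF W l] assms)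
  ultimately have "deriv2 l (x, y) (0, w) (0, y) + deriv1 l (x, y) (0, w) = 2 * deriv1 l (x, y) (0, w)"
    by (rule DERIV_unique_ev)
  then show ?thesis by simp
qed

end

section \<open>Conic pseudo-Finslerian metrics in charts\<close>

context
  fixes A :: "('m::topological_space, 'n::finite) chart set"
    and U :: "('m, 'n) tvec set" and L :: "('m, 'n) tvec \<Rightarrow> real"
  assumes atlas: "smooth_atlas A" and finsler: "conic_pseudo_finsler A U L"
begin

abbreviation chart_metric :: "('m, 'n) chart \<Rightarrow> (real ^ 'n) \<times> (real ^ 'n) \<Rightarrow> real" where
  "chart_metric c \<equiv> \<lambda>z. L (bundle_chart_inv A c z)"

lemma domain_subset: "U \<subseteq> tangent_bundle A"
  using finsler by (auto simp: conic_pseudo_finsler_def conic_domain_def)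

lemma domain_tangent_space: "v \<in> U \<Longrightarrow> v \<in> tangent_space A (fst v)"
  using domain_subset tangent_space_fst[OF atlas] by (fastforce simp: tangent_bundle_def)

text \<open>The four facts come in the order of the assumptions on a homogeneous function made
  above, so that \<open>OF chart_metric_facts\<close> transfers the Euler identities to the metric
  in a chart.\<close>

lemma chart_metric_facts:
  assumes "c \<in> A"
  shows chart_domain_open: "open (bundle_chart_image c U)"
    and chart_metric_smooth: "smooth_map_on (bundle_chart_image c U) (chart_metric c)"
    and chart_domain_conic: "\<And>x y r. (x, y) \<in> bundle_chart_image c U \<Longrightarrow> r > 0 \<Longrightarrow>
      (x, r *\<^sub>R y) \<in> bundle_chart_image c U"
    and chart_metric_homogeneous: "\<And>x y r. (x, y) \<in> bundle_chart_image c U \<Longrightarrow> r > 0 \<Longrightarrow>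
      chart_metric c (x, r *\<^sub>R y) = r\<^sup>2 * chart_metric c (x, y)"
proof -
  show "open (bundle_chart_image c U)" "smooth_map_on (bundle_chart_image c U) (chart_metric c)"
    using finsler assms by (auto simp: conic_pseudo_finsler_def conic_domain_def o_def)
  fix x y and r :: real assume xy: "(x, y) \<in> bundle_chart_image c U" and r: "r > 0"
  then obtain v where v: "v \<in> U" "fst v \<in> fst c" "bundle_chart c v = (x, y)"
    by (auto simp: bundle_chart_image_def)
  have rv: "r \<cdot>\<^sub>T v \<in> U" "L (r \<cdot>\<^sub>T v) = r\<^sup>2 * L v" "fst (r \<cdot>\<^sub>T v) = fst v"
    "bundle_chart c (r \<cdot>\<^sub>T v) = (x, r *\<^sub>R y)"
    using finsler v r
    by (auto simp: conic_pseudo_finsler_def conic_domain_def bundle_chart_def tscale_def)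
  show "(x, r *\<^sub>R y) \<in> bundle_chart_image c U"
    using rv v(2) unfolding bundle_chart_image_def by force
  have "bundle_chart_inv A c (x, r *\<^sub>R y) = r \<cdot>\<^sub>T v"
    using bundle_chart_inv_bundle_chart[OF atlas domain_tangent_space[OF rv(1)] assms] rv v(2) by simp
  moreover have "bundle_chart_inv A c (x, y) = v"
    using bundle_chart_inv_bundle_chart[OF atlas domain_tangent_space[OF v(1)] assms] v by simp
  ultimately show "chart_metric c (x, r *\<^sub>R y) = r\<^sup>2 * chart_metric c (x, y)"
    using rv by simp
qed

context
  fixes c :: "('m, 'n) chart" and v :: "('m, 'n) tvec"
  assumes c: "c \<in> A" and v: "v \<in> U" "fst v \<in> fst c"
begin

lemma chart_metric_eq:
  assumes "w \<in> tangent_space A (fst v)"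
  shows "L w = chart_metric c (snd c (fst v), snd w c)"
  using bundle_chart_inv_eq[OF atlas c v(2)] tvec_of_snd[OF atlas assms c v(2)] by simp

lemma coords_in_chart_domain: "(snd c (fst v), snd v c) \<in> bundle_chart_image c U"
  using v by (auto simp: bundle_chart_image_def bundle_chart_def intro!: rev_image_eqI)

lemma fundamental_tensor_eq:
  assumes "u \<in> tangent_space A (fst v)" "w \<in> tangent_space A (fst v)"
  shows "fundamental_tensor L v u w =
    1/2 * deriv2 (chart_metric c) (snd c (fst v), snd v c) (0, snd u c) (0, snd w c)"
proof -
  let ?z = "(snd c (fst v), snd v c)"
  have "L (v \<oplus>\<^sub>T t \<cdot>\<^sub>T u \<oplus>\<^sub>T s \<cdot>\<^sub>T w) = chart_metric c (?z + t *\<^sub>R (0, snd u c) + s *\<^sub>R (0, snd w c))" for t s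
  proof -
    have "v \<oplus>\<^sub>T t \<cdot>\<^sub>T u \<oplus>\<^sub>T s \<cdot>\<^sub>T w =
        tvec_of A c (fst v) (snd v c + t *\<^sub>R snd u c + s *\<^sub>R snd w c)"
      using tvec_of_snd[OF atlas _ c v(2)] domain_tangent_space[OF v(1)] assms
      by (simp add: tvec_of_add[OF atlas c v(2)] tvec_of_scale[OF atlas c v(2)])
    then show ?thesis by (simp add: bundle_chart_inv_eq[OF atlas c v(2)])
  qed
  then show ?thesis
    unfolding fundamental_tensor_def
    using deriv_deriv_eq_deriv2[OF chart_domain_open[OF c] chart_metric_smooth[OF c] coords_in_chart_domain,
        of "(0, snd u c)" "(0, snd w c)"] by simp
qed

text \<open>Both slots are needed: the gradient equation has \<open>v\<close> on the right,
  dissipativity has it on the left, and metric compatibility produces one term of each kind.\<close>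

lemma fundamental_tensor_radial:
  assumes "w \<in> tangent_space A (fst v)"
  shows fundamental_tensor_radial_left: "fundamental_tensor L v v w =
      1/2 * deriv1 (chart_metric c) (snd c (fst v), snd v c) (0, snd w c)"
    and fundamental_tensor_radial_right: "fundamental_tensor L v w v =
      1/2 * deriv1 (chart_metric c) (snd c (fst v), snd v c) (0, snd w c)"
  using deriv2_radial_left[OF chart_metric_facts[OF c] coords_in_chart_domain]
    deriv2_radial_right[OF chart_metric_facts[OF c] coords_in_chart_domain]
    fundamental_tensor_eq[OF domain_tangent_space[OF v(1)] assms]
    fundamental_tensor_eq[OF assms domain_tangent_space[OF v(1)]]
  by simp_all

lemma fundamental_tensor_self: "fundamental_tensor L v v v = L v"
  using fundamental_tensor_radial_left[OF domain_tangent_space[OF v(1)]]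
    euler_deriv1[OF chart_metric_facts[OF c] coords_in_chart_domain]
    chart_metric_eq[OF domain_tangent_space[OF v(1)]] by simp

text \<open>The gradient is a definite description, so existence and uniqueness both have to be
  shown. Nondegeneracy says that a linear map between spaces of equal finite dimension is injective;
  existence is then its surjectivity.\<close>

lemma anisotropic_gradient_works:
  assumes "smooth_fun_on A UNIV f"
  shows "anisotropic_gradient A L f v \<in> tangent_space A (fst v) \<and>
    (\<forall>w\<in>tangent_space A (fst v). fundamental_tensor L v (anisotropic_gradient A L f v) w = differential A f w)"
    (is "?P (anisotropic_gradient A L f v)")
proof -
  let ?T = "tangent_space A (fst v)" and ?z = "(snd c (fst v), snd v c)"
  have [simp]: "tvec_of A c (fst v) a \<in> ?T" "snd (tvec_of A c (fst v) a) c = a" for a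
    using tvec_of_in_tangent_space[OF atlas c v(2)] snd_tvec_of_self[OF atlas c v(2)] by auto
  define g where "g a b = 1/2 * deriv2 (chart_metric c) ?z (0, a) (0, b)" for a b
  have g: "fundamental_tensor L v u w = g (snd u c) (snd w c)" if "u \<in> ?T" "w \<in> ?T" for u w
    unfolding g_def using fundamental_tensor_eq[OF that] .
  note facts = chart_domain_open[OF c] chart_metric_smooth[OF c] coords_in_chart_domain
  have inr: "linear (Pair (0 :: real ^ 'n) :: real ^ 'n \<Rightarrow> _)" by (rule linearI) auto
  have g1: "linear (\<lambda>a. g a b)" for b
    unfolding g_def
    using linear_compose_scale_right[OF linear_compose[OF inr deriv2_linear1[OF facts]], of "1/2"]
    by (simp add: o_def)
  have g2: "linear (g a)" for a
    unfolding g_def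
    using linear_compose_scale_right[OF linear_compose[OF inr deriv2_linear2[OF facts]], of "1/2"]
    by (simp add: o_def)
  have nondeg: "a = 0" if "\<And>b. g a b = 0" for a
  proof -
    have "\<forall>u\<in>?T. (\<forall>w\<in>?T. fundamental_tensor L v u w = 0) \<longrightarrow> u = tzero (fst v)"
      using finsler v(1) by (auto simp: conic_pseudo_finsler_def)
    then have "tvec_of A c (fst v) a = tzero (fst v)"
      using that by (simp add: g)
    then have "snd (tvec_of A c (fst v) a) c = 0" by (simp add: tzero_def)
    then show "a = 0" by simp
  qed
  \<comment> \<open>The map from a vector to the linear form \<open>g a\<close>, with the form
    encoded by its values on the standard basis.\<close>
  define G where "G a = (\<chi> k. g a (axis k 1))" for a
  have G: "linear G"
    unfolding G_def by (rule linearI) (auto simp: vec_eq_iff linear_add[OF g1] linear_cmul[OF g1])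
  have "inj G"
  proof (rule linear_injective_0[OF G, THEN iffD2], intro allI impI)
    fix a assume "G a = 0"
    then have "g a (axis k 1) = 0" for k by (auto simp: G_def vec_eq_iff)
    then have "g a b = 0" for b using linear_axis_expansion[OF g2, of a b] by simp
    then show "a = 0" by (rule nondeg)
  qed
  then have "surj G" using G by (intro linear_inj_imp_surj)
  obtain f' where f': "(f \<circ> chart_inv c has_derivative f') (at (snd c (fst v)))"
  proof -
    have "Ck_on (Suc 0) (snd c ` fst c) (f \<circ> chart_inv c)"
      using assms c by (simp add: smooth_fun_on_def smooth_map_on_def del: Ck_on.simps)
    moreover have "open (snd c ` fst c)" using chart_image_open[OF atlas c, of UNIV] by simp
    ultimately show ?thesis using that v(2) by (meson Ck_on_SucE imageI)
  qed
  have df: "differential A f w = f' (snd w c)" if "w \<in> ?T" for w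
    using differential_eq[OF atlas c v(2) that f'] .
  from \<open>surj G\<close> obtain a where "G a = (\<chi> k. f' (axis k 1))" by (metis surjD)
  then have "g a (axis k 1) = f' (axis k 1)" for k by (simp add: G_def vec_eq_iff)
  then have ga: "g a b = f' b" for b
    using linear_axis_expansion[OF g2, of a b]
      linear_axis_expansion[OF has_derivative_linear[OF f'], of b] by simp
  have "?P (tvec_of A c (fst v) a)" by (simp add: g df ga)
  \<comment> \<open>Uniqueness is nondegeneracy applied to the difference of two solutions.\<close>
  moreover have "u = tvec_of A c (fst v) a" if "?P u" for u
  proof -
    have "g (snd u c) b = f' b" for b
      using that g[of u "tvec_of A c (fst v) b"] df[of "tvec_of A c (fst v) b"] by simp
    then have "g (snd u c - a) b = 0" for b by (simp add: linear_diff[OF g1] ga)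
    then have "snd u c = a" using nondeg by fastforce
    then show ?thesis using tvec_of_snd[OF atlas _ c v(2)] that by metis
  qed
  ultimately show ?thesis unfolding anisotropic_gradient_def by (rule theI2)
qed

end

text \<open>The fundamental tensor is homogeneous of degree zero in its base point, so it does not
  change along the ray through \<open>v\<close>. Only the case of a radial second argument is
  proved, where Euler's identity reduces it to \<open>deriv1\<close>.\<close>

lemma cartan_tensor_radial:
  assumes "v \<in> U" "w \<in> tangent_space A (fst v)"
  shows "cartan_tensor L v v v w = 0"
proof -
  obtain c where c: "c \<in> A" "fst v \<in> fst c" using chart_cover[OF atlas] by blast
  have "fundamental_tensor L (v \<oplus>\<^sub>T t \<cdot>\<^sub>T v) v w = fundamental_tensor L v v w" if "1 + t > 0" for t
  proof -
    let ?r = "1 + t" and ?x = "snd c (fst v)" and ?y = "snd v c"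
    have xy: "(?x, ?y) \<in> bundle_chart_image c U"
      using coords_in_chart_domain[OF c(1) assms(1) c(2)] .
    have eq: "v \<oplus>\<^sub>T t \<cdot>\<^sub>T v = ?r \<cdot>\<^sub>T v"
      by (auto simp: tadd_def tscale_def algebra_simps)
    have rv: "?r \<cdot>\<^sub>T v \<in> U" "fst (?r \<cdot>\<^sub>T v) = fst v" "snd (?r \<cdot>\<^sub>T v) c = ?r *\<^sub>R ?y"
      using finsler that assms(1)
      by (auto simp: conic_pseudo_finsler_def conic_domain_def tscale_def)
    have in_dom: "(?x, ?r *\<^sub>R ?y) \<in> bundle_chart_image c U"
      using chart_domain_conic[OF c(1) xy that] .
    \<comment> \<open>The factor \<open>?r\<close> arises once from linearity in the first slot and
      once from the degree of \<open>deriv1\<close>; being positive, it cancels.\<close>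
    have "?r * deriv2 (chart_metric c) (?x, ?r *\<^sub>R ?y) (0, ?y) (0, snd w c) =
        deriv2 (chart_metric c) (?x, ?r *\<^sub>R ?y) (0, ?r *\<^sub>R ?y) (0, snd w c)"
      using linear_cmul[OF deriv2_linear1[OF chart_domain_open[OF c(1)] chart_metric_smooth[OF c(1)] in_dom],
          of ?r "(0, ?y)" "(0, snd w c)"] by simp
    also have "\<dots> = ?r * deriv1 (chart_metric c) (?x, ?y) (0, snd w c)"
      using deriv2_radial_left[OF chart_metric_facts[OF c(1)] in_dom]
        deriv1_homogeneous[OF chart_metric_facts[OF c(1)] xy that] by simp
    finally have "deriv2 (chart_metric c) (?x, ?r *\<^sub>R ?y) (0, ?y) (0, snd w c) =
        deriv1 (chart_metric c) (?x, ?y) (0, snd w c)" using that by simp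
    then show ?thesis
      using fundamental_tensor_eq[OF c(1) rv(1), of v w] fundamental_tensor_radial_left[OF c(1) assms(1) c(2) assms(2)]
        rv eq c domain_tangent_space[OF assms(1)] assms(2) by simp
  qed
  moreover have "eventually (\<lambda>t::real. t \<in> {-1<..}) (nhds 0)"
    by (rule eventually_nhds_in_open) auto
  ultimately have "eventually (\<lambda>t. fundamental_tensor L (v \<oplus>\<^sub>T t \<cdot>\<^sub>T v) v w = fundamental_tensor L v v w) (nhds 0)"
    by (auto elim: eventually_mono)
  then have "deriv (\<lambda>t. fundamental_tensor L (v \<oplus>\<^sub>T t \<cdot>\<^sub>T v) v w) 0 =
      deriv (\<lambda>t. fundamental_tensor L v v w) 0"
    by (intro deriv_cong_ev) auto
  then show ?thesis by (simp add: cartan_tensor_def)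
qed

end

section \<open>The Chern connection in the radial direction\<close>

text \<open>For constant coefficients the Leibniz term contains the differential of a constant and
  vanishes. The resulting bilinearity is what expands the connection on constant-component fields
  into Christoffel symbols.\<close>

lemma connection_constant_fields_bilinear:
  fixes A :: "('m::topological_space, 'n::finite) chart set"
  assumes atlas: "smooth_atlas A" and c: "c \<in> A"
    and \<Omega>: "open \<Omega>" "\<Omega> \<subseteq> fst c" "p \<in> \<Omega>"
    and D: "linear_connection_on A \<Omega> D"
  defines "K \<equiv> \<lambda>a q. bundle_chart_inv A c (snd c q, a)"
  shows "linear (\<lambda>a. snd (D (K a) (K b) p) c)" "linear (\<lambda>b. snd (D (K a) (K b) p) c)"
proof -
  have K: "vector_field_on A \<Omega> (K a)" for a
    unfolding K_def by (rule vector_field_constant_components[OF atlas c \<Omega>(1,2)])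
  have add: "K (a + b) q = K a q \<oplus>\<^sub>T K b q" if "q \<in> \<Omega>" for a b q
    using that \<Omega>(2) by (auto simp: K_def bundle_chart_inv_eq[OF atlas c] tvec_of_add[OF atlas c])
  have scale: "K (r *\<^sub>R a) q = r \<cdot>\<^sub>T K a q" if "q \<in> \<Omega>" for r a q
    using that \<Omega>(2) by (auto simp: K_def bundle_chart_inv_eq[OF atlas c] tvec_of_scale[OF atlas c])
  have const: "smooth_fun_on A \<Omega> (\<lambda>_. r)" for r
    using chart_image_open[OF atlas _ \<Omega>(1)]
    by (auto simp: smooth_fun_on_def smooth_map_on_def o_def intro: Ck_on_const)
  have dconst: "differential A (\<lambda>_. r) (K a p) = 0" for r a
  proof -
    have "((\<lambda>_. r) \<circ> chart_inv c has_derivative (\<lambda>_. 0)) (at (snd c p))"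
      by (simp add: o_def)
    moreover have "K a p \<in> tangent_space A p"
      using K \<Omega>(3) by (auto simp: vector_field_on_def)
    ultimately show ?thesis
      using differential_eq[OF atlas c, of p "K a p"] \<Omega> by blast
  qed
  \<comment> \<open>Sums and multiples of the fields \<open>K a\<close> are again of this form only
    on \<open>\<Omega>\<close>, since outside the chart \<open>bundle_chart_inv\<close> is
    unspecified; as total functions they may differ.\<close>
  have cong: "D X Y p = D X' Y' p" if "vector_field_on A \<Omega> X" "vector_field_on A \<Omega> Y"
    "\<And>q. q \<in> \<Omega> \<Longrightarrow> X q = X' q" "\<And>q. q \<in> \<Omega> \<Longrightarrow> Y q = Y' q" for X X' Y Y'
    by (rule D[unfolded linear_connection_on_def, THEN conjunct1, rule_format]) (use that \<Omega>(3) in auto)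
  note D_rules = D[unfolded linear_connection_on_def, THEN conjunct2, THEN conjunct2]
  show "linear (\<lambda>a. snd (D (K a) (K b) p) c)"
  proof (rule linearI)
    fix a a' and r :: real
    have "D (K (a + a')) (K b) p = D (\<lambda>q. K a q \<oplus>\<^sub>T K a' q) (K b) p"
      by (rule cong) (use K add in auto)
    also have "\<dots> = D (K a) (K b) p \<oplus>\<^sub>T D (K a') (K b) p"
      by (rule D_rules[THEN conjunct1, rule_format]) (use K \<Omega>(3) in auto)
    finally show "snd (D (K (a + a')) (K b) p) c = snd (D (K a) (K b) p) c + snd (D (K a') (K b) p) c"
      by (simp add: tadd_def)
    have "D (K (r *\<^sub>R a)) (K b) p = D (\<lambda>q. r \<cdot>\<^sub>T K a q) (K b) p"
      by (rule cong) (use K scale in auto)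
    also have "\<dots> = r \<cdot>\<^sub>T D (K a) (K b) p"
      by (rule D_rules[THEN conjunct2, THEN conjunct1, rule_format]) (use K const \<Omega>(3) in auto)
    finally show "snd (D (K (r *\<^sub>R a)) (K b) p) c = r *\<^sub>R snd (D (K a) (K b) p) c"
      by (simp add: tscale_def)
  qed
  show "linear (\<lambda>b. snd (D (K a) (K b) p) c)"
  proof (rule linearI)
    fix b b' and r :: real
    have "D (K a) (K (b + b')) p = D (K a) (\<lambda>q. K b q \<oplus>\<^sub>T K b' q) p"
      by (rule cong) (use K add in auto)
    also have "\<dots> = D (K a) (K b) p \<oplus>\<^sub>T D (K a) (K b') p"
      by (rule D_rules[THEN conjunct2, THEN conjunct2, THEN conjunct1, rule_format]) (use K \<Omega>(3) in auto)
    finally show "snd (D (K a) (K (b + b')) p) c = snd (D (K a) (K b) p) c + snd (D (K a) (K b') p) c"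
      by (simp add: tadd_def)
    have "D (K a) (K (r *\<^sub>R b)) p = D (K a) (\<lambda>q. r \<cdot>\<^sub>T K b q) p"
      by (rule cong) (use K scale in auto)
    also have "\<dots> = r \<cdot>\<^sub>T D (K a) (K b) p \<oplus>\<^sub>T differential A (\<lambda>_. r) (K a p) \<cdot>\<^sub>T K b p"
      by (rule D_rules[THEN conjunct2, THEN conjunct2, THEN conjunct2, rule_format]) (use K const \<Omega>(3) in auto)
    finally show "snd (D (K a) (K (r *\<^sub>R b)) p) c = r *\<^sub>R snd (D (K a) (K b) p) c"
      by (simp add: tscale_def tadd_def dconst)
  qed
qed

text \<open>The derivative of \<open>g_V(V, V) = L(V)\<close> along \<open>v\<close> is computed in
  two ways. In the chart it is the base derivative of L, because the fibre component of
  \<open>V\<close> is constant. By compatibility it is \<open>g_v(w, v) + g_v(v, w)\<close>, where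
  \<open>w\<close> is the covariant derivative of \<open>V\<close> along itself; its components are
  the double Christoffel sum.\<close>

lemma chern_connection_horizontal:
  fixes A :: "('m::topological_space, 'n::finite) chart set"
  assumes atlas: "smooth_atlas A" and finsler: "conic_pseudo_finsler A U L"
    and chern: "chern_connection A U L nabla"
    and c: "c \<in> A" and v: "v \<in> U" "fst v \<in> fst c"
  shows "1/2 * deriv1 (chart_metric A L c) (snd c (fst v), snd v c) (snd v c, 0) =
    1/2 * deriv1 (chart_metric A L c) (snd c (fst v), snd v c)
      (0, \<chi> k. \<Sum>i\<in>UNIV. \<Sum>j\<in>UNIV. christoffel A nabla c v i j k * (snd v c $ i) * (snd v c $ j))"
    (is "_ = 1/2 * deriv1 _ _ (0, ?G)")
proof -
  define p where "p = fst v"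
  define a where "a = snd v c"
  define K where "K b q = bundle_chart_inv A c (snd c q, b)" for b q
  define V where "V = K a"
  let ?W = "bundle_chart_image c U"
  \<comment> \<open>The neighbourhood of \<open>p\<close> on which the constant extension of
    \<open>v\<close> stays in \<open>U\<close>, as metric compatibility demands of a reference
    field.\<close>
  define \<Omega> where "\<Omega> = fst c \<inter> (\<lambda>q. (snd c q, a)) -` ?W"
  have vT: "v \<in> tangent_space A p"
    unfolding p_def using domain_tangent_space[OF atlas finsler v(1)] .
  have W: "open ?W" by (rule chart_domain_open[OF atlas finsler c])
  have "continuous_on (fst c) (snd c)"
    using chart_homeomorphism[OF atlas c] by (simp add: homeomorphism_def)
  then have op: "open \<Omega>"
    unfolding \<Omega>_def using W chart_open[OF atlas c]
    by (intro continuous_open_preimage) (auto intro!: continuous_intros)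
  have sub: "\<Omega> \<subseteq> fst c" by (auto simp: \<Omega>_def)
  have xa: "(snd c p, a) \<in> ?W"
    unfolding p_def a_def using coords_in_chart_domain[OF atlas finsler c v] .
  have p: "p \<in> fst c" "p \<in> \<Omega>" using v(2) xa by (auto simp: \<Omega>_def p_def)
  have Vp: "V p = v"
    unfolding V_def K_def bundle_chart_inv_eq[OF atlas c p(1)] a_def
    using tvec_of_snd[OF atlas vT c p(1)] .
  have V: "V q \<in> U" "V q \<in> tangent_space A q" "fst (V q) = q" "snd (V q) c = a" if "q \<in> \<Omega>" for q
  proof -
    have q: "q \<in> fst c" "(snd c q, a) \<in> ?W" using that by (auto simp: \<Omega>_def)
    have Vq: "V q = tvec_of A c q a"
      by (simp add: V_def K_def bundle_chart_inv_eq[OF atlas c q(1)])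
    show "V q \<in> U"
      using q bundle_chart_image_iff[OF atlas domain_subset[OF atlas finsler] c q(1)] by (simp add: Vq)
    show "V q \<in> tangent_space A q" "fst (V q) = q" "snd (V q) c = a"
      using tvec_of_in_tangent_space[OF atlas c q(1)] snd_tvec_of_self[OF atlas c q(1)]
        fst_tvec_of[OF atlas] by (auto simp: Vq)
  qed
  have VF: "vector_field_on A \<Omega> V"
    unfolding V_def K_def by (rule vector_field_constant_components[OF atlas c op sub])
  have VU: "V ` \<Omega> \<subseteq> U" using V by auto
  let ?D = "connection_along A nabla V"
  have D: "linear_connection_on A \<Omega> ?D"
    using chern op VF VU unfolding chern_connection_def anisotropic_connection_def by blast
  have bil: "linear (\<lambda>a. snd (?D (K a) (K b) p) c)" "linear (\<lambda>b. snd (?D (K a) (K b) p) c)" for a b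
    unfolding K_def by (rule connection_constant_fields_bilinear[OF atlas c op sub p(2) D])+
  have coord: "coordinate_field A c i = K (axis i 1)" for i
    by (simp add: fun_eq_iff coordinate_field_def K_def)
  have chris: "snd (?D (K (axis i 1)) (K (axis j 1)) p) c $ k = christoffel A nabla c v i j k" for i j k
    by (simp add: christoffel_def connection_along_def Vp coord)
  define w where "w = ?D V V p"
  have "vector_field_on A \<Omega> (?D V V)"
    by (rule D[unfolded linear_connection_on_def, THEN conjunct2, THEN conjunct1, rule_format])
      (use VF in auto)
  then have wT: "w \<in> tangent_space A p"
    using p(2) by (simp add: vector_field_on_def w_def)
  have "snd w c = (\<Sum>i\<in>UNIV. (a $ i) *\<^sub>R snd (?D (K (axis i 1)) (K a) p) c)"
    using linear_axis_expansion[OF bil(1), of a a] unfolding w_def V_def .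
  also have "\<dots> = (\<Sum>i\<in>UNIV. (a $ i) *\<^sub>R (\<Sum>j\<in>UNIV. (a $ j) *\<^sub>R snd (?D (K (axis i 1)) (K (axis j 1)) p) c))"
    using linear_axis_expansion[OF bil(2), of _ a] by simp
  finally have wc: "snd w c = ?G"
    by (simp add: vec_eq_iff chris sum_distrib_left mult_ac flip: a_def)
  have "metric_compatible A U L nabla" using chern by (simp add: chern_connection_def)
  \<comment> \<open>All four fields are \<open>V\<close>, so the Cartan tensor has \<open>v\<close>
    as its base point and in its first two arguments, which is the vanishing case.\<close>
  from this[unfolded metric_compatible_def, rule_format, of \<Omega> V V V V p]
  have "differential A (\<lambda>q. fundamental_tensor L (V q) (V q) (V q)) (V p) =
      fundamental_tensor L v w v + fundamental_tensor L v v w + 2 * cartan_tensor L v v v w"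
    using op VF VU p(2) by (simp add: w_def Vp)
  also have "\<dots> = deriv1 (chart_metric A L c) (snd c p, a) (0, ?G)"
    using cartan_tensor_radial[OF atlas finsler v(1)] wT
      fundamental_tensor_radial_left[OF atlas finsler c v, of w]
      fundamental_tensor_radial_right[OF atlas finsler c v, of w]
    by (simp add: wc flip: p_def a_def)
  finally have 1: "differential A (\<lambda>q. fundamental_tensor L (V q) (V q) (V q)) (V p) =
      deriv1 (chart_metric A L c) (snd c p, a) (0, ?G)" .
  \<comment> \<open>The direct evaluation: only the base coordinate moves, with \<open>a\<close>
    held fixed.\<close>
  have "((\<lambda>x. (x, a)) has_derivative (\<lambda>b. (b, 0))) (at (snd c p))"
    by (auto intro!: derivative_eq_intros)
  then have "((\<lambda>x. chart_metric A L c (x, a)) has_derivative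
      (\<lambda>b. deriv1 (chart_metric A L c) (snd c p, a) (b, 0))) (at (snd c p))"
    by (rule has_derivative_compose) (rule deriv1[OF W chart_metric_smooth[OF atlas finsler c] xa])
  then have "((\<lambda>q. fundamental_tensor L (V q) (V q) (V q)) \<circ> chart_inv c has_derivative
      (\<lambda>b. deriv1 (chart_metric A L c) (snd c p, a) (b, 0))) (at (snd c p))"
  proof (rule has_derivative_transform_within_open[where s = "snd c ` (fst c \<inter> \<Omega>)"])
    fix x assume "x \<in> snd c ` (fst c \<inter> \<Omega>)"
    then obtain q where q: "q \<in> fst c" "q \<in> \<Omega>" "x = snd c q" by blast
    then show "chart_metric A L c (x, a) = ((\<lambda>q. fundamental_tensor L (V q) (V q) (V q)) \<circ> chart_inv c) x"
      using fundamental_tensor_self[OF atlas finsler c, of "V q"] V[of q]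
        chart_inv_chart[OF atlas c]
      by (simp add: V_def K_def)
  qed (use p chart_image_open[OF atlas c op] in auto)
  from differential_eq[OF atlas c p(1) vT[folded Vp] this]
  have "differential A (\<lambda>q. fundamental_tensor L (V q) (V q) (V q)) (V p) =
      deriv1 (chart_metric A L c) (snd c p, a) (a, 0)"
    using V(4)[OF p(2)] by simp
  with 1 show ?thesis by (simp flip: p_def a_def)
qed

section \<open>Energy along motions\<close>

text \<open>The mean value argument takes two-sided derivatives strictly between \<open>r\<close>
  and \<open>s\<close>, where differentiating within \<open>I\<close> is the same, and continuity at
  \<open>r\<close> and \<open>s\<close>, which the one-sided derivatives provide.\<close>

lemma strict_antimono_on_interval:
  fixes f :: "real \<Rightarrow> real"
  assumes "is_interval I"
    and "\<And>t. t \<in> I \<Longrightarrow> \<exists>d<0. (f has_real_derivative d) (at t within I)"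
  shows "strict_antimono_on I f"
proof (rule monotone_onI)
  fix r s assume rs: "r \<in> I" "s \<in> I" "r < s"
  then have sub: "{r..s} \<subseteq> I"
    using mem_is_interval_1_I[OF assms(1) rs(1,2)] by auto
  have "continuous_on I f"
    unfolding continuous_on_eq_continuous_within using assms(2) DERIV_continuous by blast
  then have "continuous_on {r..s} f" using sub by (rule continuous_on_subset)
  moreover have "\<exists>d. (f has_real_derivative d) (at x) \<and> d < 0" if "r < x" "x < s" for x
  proof -
    have "at x within I = at x"
      using sub that at_within_open_subset[of x "{r<..<s}" I] by fastforce
    moreover have "x \<in> I" using sub that by auto
    ultimately show ?thesis using assms(2)[of x] by auto
  qed
  ultimately show "f r > f s" using DERIV_neg_imp_decreasing_open[OF rs(3)] by blast
qed

text \<open>Smoothness is given on the set \<open>J\<close> of times spent in the chart, while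
  \<open>velocity\<close> and \<open>covariant_derivative\<close> differentiate within
  \<open>I\<close>. By continuity \<open>J\<close> is relatively open in \<open>I\<close>, so the
  two filters agree at its points.\<close>

lemma smooth_curve_chart_derivatives:
  assumes atlas: "smooth_atlas A" and \<gamma>: "smooth_curve A I \<gamma>"
    and c: "c \<in> A" and t: "t \<in> I" "\<gamma> t \<in> fst c"
  obtains J where "t \<in> J" "at t within J = at t within I"
    and "\<And>s. s \<in> J \<Longrightarrow> s \<in> I \<and> \<gamma> s \<in> fst c"
    and "((\<lambda>s. snd c (\<gamma> s)) has_vector_derivative snd (velocity A I \<gamma> t) c) (at t within I)"
    and "((\<lambda>s. snd (velocity A I \<gamma> s) c) has_vector_derivative
      (\<chi> k. vector_derivative (\<lambda>s. snd (velocity A I \<gamma> s) c $ k) (at t within I))) (at t within I)"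
proof -
  define J where "J = {t \<in> I. \<gamma> t \<in> fst c}"
  have I: "is_interval I" "interior I \<noteq> {}" "continuous_on I \<gamma>"
    and smooth: "smooth_map_on J (snd c \<circ> \<gamma>)"
    using \<gamma> c by (auto simp: smooth_curve_def J_def)
  from I(3) chart_open[OF atlas c] obtain T where T: "open T" "T \<inter> I = \<gamma> -` fst c \<inter> I"
    unfolding continuous_on_open_invariant by blast
  have within: "at s within J = at s within I" if "s \<in> J" for s
    using that T by (intro at_within_nhd[of s T]) (auto simp: J_def)
  \<comment> \<open>A nondegenerate interval has no isolated points; this makes vector derivatives
    within \<open>I\<close> unique, also at endpoints.\<close>
  have nontrivial: "at s within I \<noteq> bot" if "s \<in> J" for s
  proof -
    have "\<nexists>a. I = {a}" using I(2) by auto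
    then show ?thesis
      using connected_imp_perfect[OF is_interval_connected[OF I(1)], of s] that
      by (auto simp: trivial_limit_within J_def)
  qed
  have "Ck_on (Suc (Suc 0)) J (snd c \<circ> \<gamma>)" using smooth by (simp add: smooth_map_on_def del: Ck_on.simps)
  then have x_diff: "(snd c \<circ> \<gamma>) differentiable_on J"
    and C1: "Ck_on (Suc 0) J (\<lambda>s. frechet_derivative (snd c \<circ> \<gamma>) (at s within J) 1)"
    by (auto simp del: Ck_on.simps(1) simp: Ck_on.simps(2))
  have vel: "snd (velocity A I \<gamma> s) c = vector_derivative (snd c \<circ> \<gamma>) (at s within I)" if "s \<in> J" for s
    using that c by (simp add: velocity_def J_def)
  have x_deriv: "((snd c \<circ> \<gamma>) has_vector_derivative snd (velocity A I \<gamma> s) c) (at s within I)"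
    if "s \<in> J" for s
  proof -
    have "(snd c \<circ> \<gamma>) differentiable (at s within J)"
      using x_diff that by (simp add: differentiable_on_def)
    then have "(snd c \<circ> \<gamma>) differentiable (at s within I)" by (simp only: within[OF that])
    then show ?thesis by (simp add: vel[OF that] vector_derivative_works)
  qed
  \<comment> \<open>A linear map on the reals is determined by its value at 1, so the second order
    of smoothness of the curve becomes differentiability of the velocity components.\<close>
  have "frechet_derivative (snd c \<circ> \<gamma>) (at s within J) 1 = snd (velocity A I \<gamma> s) c" if "s \<in> J" for s
  proof -
    have F: "((snd c \<circ> \<gamma>) has_derivative frechet_derivative (snd c \<circ> \<gamma>) (at s within J)) (at s within I)"
      unfolding within[OF that, symmetric]
      using x_diff that by (simp add: differentiable_on_def frechet_derivative_works)
    have "((snd c \<circ> \<gamma>) has_vector_derivative frechet_derivative (snd c \<circ> \<gamma>) (at s within J) 1) (at s within I)"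
    proof -
      have "frechet_derivative (snd c \<circ> \<gamma>) (at s within J) h =
          h *\<^sub>R frechet_derivative (snd c \<circ> \<gamma>) (at s within J) 1" for h
        using linear_cmul[OF has_derivative_linear[OF F], of h 1] by simp
      then have "(\<lambda>h. h *\<^sub>R frechet_derivative (snd c \<circ> \<gamma>) (at s within J) 1) =
          frechet_derivative (snd c \<circ> \<gamma>) (at s within J)" by (intro ext) (rule sym)
      with F show ?thesis by (simp only: has_vector_derivative_def)
    qed
    from vector_derivative_within[OF nontrivial[OF that] this] show ?thesis by (simp add: vel[OF that])
  qed
  then have "Ck_on (Suc 0) J (\<lambda>s. snd (velocity A I \<gamma> s) c)"
    using C1 by (rule Ck_on_cong[THEN iffD1])
  moreover have tJ: "t \<in> J" using t by (simp add: J_def)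
  ultimately have "(\<lambda>s. snd (velocity A I \<gamma> s) c) differentiable (at t within I)"
    using within by (auto simp: differentiable_on_def)
  then obtain y' where y': "((\<lambda>s. snd (velocity A I \<gamma> s) c) has_vector_derivative y') (at t within I)"
    by (auto simp: vector_derivative_works)
  \<comment> \<open>\<open>covariant_derivative\<close> differentiates each component separately;
    here these derivatives are assembled into the derivative of the component vector.\<close>
  have "vector_derivative (\<lambda>s. snd (velocity A I \<gamma> s) c $ k) (at t within I) = y' $ k" for k
    using bounded_linear.has_vector_derivative[OF bounded_linear_vec_nth y']
    by (rule vector_derivative_within[OF nontrivial[OF tJ]])
  then have eq: "(\<chi> k. vector_derivative (\<lambda>s. snd (velocity A I \<gamma> s) c $ k) (at t within I)) = y'"
    by (simp add: vec_eq_iff)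
  show ?thesis
    by (rule that[OF tJ within[OF tJ] _ x_deriv[OF tJ, unfolded o_def] y'[folded eq]])
      (simp add: J_def)
qed

lemma energy_has_derivative:
  fixes A :: "('m::topological_space, 'n::finite) chart set"
  assumes atlas: "smooth_atlas A" and finsler: "conic_pseudo_finsler A U L"
    and chern: "chern_connection A U L nabla"
    and dissipative: "dissipative_system A U L F \<phi> Y" and motion: "motion A U nabla F I \<gamma>"
    and t: "t \<in> I"
  shows "((\<lambda>t. total_energy L \<phi> (velocity A I \<gamma> t)) has_real_derivative
    fundamental_tensor L (velocity A I \<gamma> t) (velocity A I \<gamma> t) (Y (velocity A I \<gamma> t))) (at t within I)"
proof -
  define v where "v = velocity A I \<gamma> t"
  define p where "p = \<gamma> t"
  have U: "velocity A I \<gamma> s \<in> U" if "s \<in> I" for s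
    using motion that by (simp add: motion_def)
  have fst_vel [simp]: "fst (velocity A I \<gamma> s) = \<gamma> s" for s
    by (simp add: velocity_def)
  have v: "v \<in> U" "fst v = p" using U[OF t] by (simp_all add: v_def p_def)
  have vT: "v \<in> tangent_space A p" using domain_tangent_space[OF atlas finsler v(1)] v(2) by simp
  obtain c where c: "c \<in> A" "p \<in> fst c" using chart_cover[OF atlas] by blast
  define l where "l = chart_metric A L c"
  define x where "x s = snd c (\<gamma> s)" for s
  define y where "y s = snd (velocity A I \<gamma> s) c" for s
  define y' where "y' = (\<chi> k. vector_derivative (\<lambda>s. y s $ k) (at t within I))"
  have curve: "smooth_curve A I \<gamma>" using motion by (simp add: motion_def)
  obtain J where J: "t \<in> J" "at t within J = at t within I" "\<And>s. s \<in> J \<Longrightarrow> s \<in> I \<and> \<gamma> s \<in> fst c"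
    and x': "(x has_vector_derivative y t) (at t within I)"
    and y'': "(y has_vector_derivative y') (at t within I)"
    using smooth_curve_chart_derivatives[OF atlas curve c(1) t c(2)[unfolded p_def]]
    unfolding x_def y_def y'_def by blast
  have xt: "x t = snd c p" and yt: "y t = snd v c" by (simp_all add: x_def y_def p_def v_def)
  let ?W = "bundle_chart_image c U"
  have W: "open ?W" and l_smooth: "smooth_map_on ?W l"
    using chart_domain_open[OF atlas finsler c(1)] chart_metric_smooth[OF atlas finsler c(1)]
    by (simp_all add: l_def)
  have z: "(x t, y t) \<in> ?W"
    using coords_in_chart_domain[OF atlas finsler c(1) v(1)] c v by (simp add: xt yt)
  have lin: "linear (deriv1 l (x t, y t))" by (rule deriv1_linear[OF W l_smooth z])
  have radial: "fundamental_tensor L v v w = 1/2 * deriv1 l (x t, y t) (0, snd w c)"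
    "fundamental_tensor L v w v = 1/2 * deriv1 l (x t, y t) (0, snd w c)"
    if "w \<in> tangent_space A p" for w
    using fundamental_tensor_radial_left[OF atlas finsler c(1) v(1), of w]
      fundamental_tensor_radial_right[OF atlas finsler c(1) v(1), of w] that c v
    by (simp_all add: l_def xt yt)

  have \<phi>: "smooth_fun_on A UNIV \<phi>" and Y: "anisotropic_field A U Y"
    and F: "F v = (-1) \<cdot>\<^sub>T anisotropic_gradient A L \<phi> v \<oplus>\<^sub>T Y v"
    using dissipative v(1) by (auto simp: dissipative_system_def dissipative_field_def)
  have YT: "Y v \<in> tangent_space A p" using Y v by (auto simp: anisotropic_field_def)
  define grad where "grad = anisotropic_gradient A L \<phi> v"
  have grad: "grad \<in> tangent_space A p" "fundamental_tensor L v grad v = differential A \<phi> v"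
    using anisotropic_gradient_works[OF atlas finsler c(1) v(1) _ \<phi>] c v vT by (simp_all add: grad_def)
  obtain \<phi>' where \<phi>': "(\<phi> \<circ> chart_inv c has_derivative \<phi>') (at (x t))"
  proof -
    have "Ck_on (Suc 0) (snd c ` fst c) (\<phi> \<circ> chart_inv c)"
      using \<phi> c by (simp add: smooth_fun_on_def smooth_map_on_def del: Ck_on.simps)
    moreover have "open (snd c ` fst c)" using chart_image_open[OF atlas c(1), of UNIV] by simp
    ultimately show ?thesis using that c(2) unfolding xt by (meson Ck_on_SucE imageI)
  qed
  have d\<phi>: "differential A \<phi> v = \<phi>' (y t)"
    using differential_eq[OF atlas c vT, of \<phi> \<phi>'] \<phi>' by (simp add: xt yt)

  define G where "G = (\<chi> k. \<Sum>i\<in>UNIV. \<Sum>j\<in>UNIV. christoffel A nabla c v i j k * (y t $ i) * (y t $ j))"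
  have horizontal: "deriv1 l (x t, y t) (y t, 0) = deriv1 l (x t, y t) (0, G)"
    using chern_connection_horizontal[OF atlas finsler chern c(1) v(1)] c v
    by (simp add: G_def l_def xt yt)
  \<comment> \<open>The equation of motion in the chart: coordinate acceleration plus Christoffel
    term is the component vector of the force.\<close>
  have "F v = covariant_derivative A nabla I \<gamma> (velocity A I \<gamma>) t"
    using motion t by (simp add: motion_def v_def)
  then have "snd (F v) c = y' + G"
    using c by (simp add: covariant_derivative_def y'_def G_def y_def p_def v_def vec_eq_iff)
  then have acc: "y' + G = snd (Y v) c - snd grad c"
    by (simp add: F grad_def tadd_def tscale_def)

  have "((\<lambda>s. (x s, y s)) has_derivative (\<lambda>h. (h *\<^sub>R y t, h *\<^sub>R y'))) (at t within I)"
    using x' y'' unfolding has_vector_derivative_def by (rule has_derivative_Pair)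
  from has_derivative_compose[OF this deriv1[OF W l_smooth z]]
  have "((\<lambda>s. l (x s, y s)) has_derivative (\<lambda>h. deriv1 l (x t, y t) (h *\<^sub>R (y t, y')))) (at t within I)"
    by simp
  then have l': "((\<lambda>s. l (x s, y s)) has_real_derivative deriv1 l (x t, y t) (y t, y')) (at t within I)"
    by (simp only: linear_cmul[OF lin] has_field_derivative_def real_scaleR_def mult_commute_abs)
  from has_derivative_compose[OF x'[unfolded has_vector_derivative_def] \<phi>']
  have p': "((\<lambda>s. (\<phi> \<circ> chart_inv c) (x s)) has_real_derivative \<phi>' (y t)) (at t within I)"
    by (simp only: linear_cmul[OF has_derivative_linear[OF \<phi>']] has_field_derivative_def
        real_scaleR_def mult_commute_abs)
  have energy: "total_energy L \<phi> (velocity A I \<gamma> s) = 1/2 * l (x s, y s) + (\<phi> \<circ> chart_inv c) (x s)"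
    if "s \<in> J" for s
    using J(3)[OF that] chart_metric_eq[OF atlas finsler c(1), of "velocity A I \<gamma> s" "velocity A I \<gamma> s"] U[of s]
      domain_tangent_space[OF atlas finsler U] chart_inv_chart[OF atlas c(1)]
    by (simp add: total_energy_def l_def x_def y_def)
  have "((\<lambda>s. 1/2 * l (x s, y s) + (\<phi> \<circ> chart_inv c) (x s)) has_real_derivative
      1/2 * deriv1 l (x t, y t) (y t, y') + \<phi>' (y t)) (at t within I)"
    by (intro DERIV_add DERIV_cmult l' p')
  \<comment> \<open>The chart expression of the energy is valid only on \<open>J\<close>, so the
    derivative is transferred within \<open>J\<close> and then read within \<open>I\<close>.\<close>
  then have E: "((\<lambda>s. total_energy L \<phi> (velocity A I \<gamma> s)) has_real_derivative
      1/2 * deriv1 l (x t, y t) (y t, y') + \<phi>' (y t)) (at t within I)"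
    unfolding J(2)[symmetric] has_field_derivative_def
    by (rule has_derivative_transform[OF J(1), rotated]) (rule energy)
  \<comment> \<open>The horizontal part \<open>(y t, 0)\<close> may be replaced by the vertical
    \<open>(0, G)\<close>, which completes \<open>y'\<close> to the covariant acceleration.\<close>
  have "deriv1 l (x t, y t) (y t, y') = deriv1 l (x t, y t) ((y t, 0) + (0, y'))" by simp
  also have "\<dots> = deriv1 l (x t, y t) (0, G) + deriv1 l (x t, y t) (0, y')"
    by (simp only: linear_add[OF lin] horizontal)
  also have "\<dots> = deriv1 l (x t, y t) (0, snd (Y v) c - snd grad c)"
    using linear_add[OF lin, of "(0, y')" "(0, G)"] by (simp add: acc)
  also have "\<dots> = deriv1 l (x t, y t) (0, snd (Y v) c) - deriv1 l (x t, y t) (0, snd grad c)"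
    using linear_diff[OF lin, of "(0, snd (Y v) c)" "(0, snd grad c)"] by simp
  \<comment> \<open>Half of the \<open>grad\<close> term is \<open>g_v(grad, v)\<close>, the
    differential of \<phi> on \<open>v\<close>, and enters with the sign opposite to
    \<open>\<phi>' (y t)\<close>; only the \<open>Y\<close> term survives.\<close>
  finally have "1/2 * deriv1 l (x t, y t) (y t, y') + \<phi>' (y t) = fundamental_tensor L v v (Y v)"
    using radial(1)[OF YT] radial(2)[OF grad(1)] grad(2) d\<phi> by (simp add: field_simps)
  with E show ?thesis by (simp add: v_def)
qed

theorem proposition4p13:
  fixes A :: "('m::{t2_space, second_countable_topology}, 'n::finite) chart set"
    and U :: "('m, 'n) tvec set"
    and L :: "('m, 'n) tvec \<Rightarrow> real"
    and nabla :: "('m, 'n) aniso_conn"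
    and F Y :: "('m, 'n) tvec \<Rightarrow> ('m, 'n) tvec"
    and \<phi> :: "'m \<Rightarrow> real"
    and I :: "real set"
    and \<gamma> :: "real \<Rightarrow> 'm"
  assumes "smooth_atlas A"
    and "conic_pseudo_finsler A U L"
    and "chern_connection A U L nabla"
    and "dissipative_system A U L F \<phi> Y"
    and "motion A U nabla F I \<gamma>"
  shows "strict_antimono_on I (\<lambda>t. total_energy L \<phi> (velocity A I \<gamma> t))"
proof (rule strict_antimono_on_interval)
  show "is_interval I" using assms(5) by (simp add: motion_def smooth_curve_def)
  fix t assume t: "t \<in> I"
  then have "velocity A I \<gamma> t \<in> U" using assms(5) by (simp add: motion_def)
  then have "fundamental_tensor L (velocity A I \<gamma> t) (velocity A I \<gamma> t) (Y (velocity A I \<gamma> t)) < 0"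
    using assms(4) by (simp add: dissipative_system_def dissipative_field_def)
  then show "\<exists>d<0. ((\<lambda>t. total_energy L \<phi> (velocity A I \<gamma> t)) has_real_derivative d) (at t within I)"
    using energy_has_derivative[OF assms t] by blast
qed

end
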